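(* For every integer $L \ge 1$, $$N_{Z,{\rm sq},{\rm PF},L} = \frac{1}{2} \left[ N_{Z,{\rm tri},{\rm PF},L} + \binom{L}{\lfloor L/2\rfloor} \right].$$
   Context: A set partition of $\{1,2,\ldots,L\}$ is non-crossing if there are no $a<b<c<d$ such that $a,c$ belong to one block and $b,d$ belong to a different block. Regard $1,\ldots,L$ as the vertices, in cyclic order, of a circuit with $L$ vertices. The rotation $i \mapsto i+1 \pmod L$ and the reflection $i \mapsto L+1-i$ act on the set of non-crossing partitions of $\{1,\ldots,L\}$. $N_{Z,{\rm tri},{\rm PF},L}$ is the number of equivalence classes (orbits) of non-crossing partitions of $\{1,\ldots,L\}$ under the group generated by the rotation. (This is the dimension of the translation-invariant transfer matrix, in the Fortuin-Kasteleyn representation, of the Potts model on a triangular-lattice strip of width $L$ with periodic transverse and free longitudinal boundary conditions.) $N_{Z,{\rm sq},{\rm PF},L}$ is the number of equivalence classes (orbits) of non-crossing partitions of $\{1,\ldots,L\}$ under the group generated by the rotation and the reflection. (This is the corresponding dimension for the square-lattice strip.) *)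

theory Defs
  imports
    "HOL-Library.Disjoint_Sets"
    "HOL-Algebra.Algebra"
begin

section \<open>Non-crossing partitions\<close>

definition noncrossing :: "nat set set \<Rightarrow> bool" where
  "noncrossing P \<longleftrightarrow>
     \<not> (\<exists>a b c d. a < b \<and> b < c \<and> c < d \<and>
          (\<exists>B\<in>P. \<exists>C\<in>P. B \<noteq> C \<and> a \<in> B \<and> c \<in> B \<and> b \<in> C \<and> d \<in> C))"

definition NCP :: "nat \<Rightarrow> nat set set set" where
  "NCP L = {P. partition_on {1..L} P \<and> noncrossing P}"

section \<open>Rotation and reflection of the circuit\<close>

text \<open>
  The vertices are \<open>1, \<dots>, L\<close>, so the residue of \<open>i + 1\<close> modulo \<open>L\<close> is taken in \<open>{1..L}\<close>.
  As elements of \<^const>\<open>sym_group\<close>, the two maps fix every number outside \<open>{1..L}\<close>.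
\<close>

definition rotation :: "nat \<Rightarrow> nat \<Rightarrow> nat" where
  "rotation L i = (if i \<in> {1..L} then i mod L + 1 else i)"

definition reflection :: "nat \<Rightarrow> nat \<Rightarrow> nat" where
  "reflection L i = (if i \<in> {1..L} then L + 1 - i else i)"

definition partition_action :: "nat \<Rightarrow> (nat \<Rightarrow> nat) \<Rightarrow> nat set set \<Rightarrow> nat set set" where
  "partition_action L g = (\<lambda>P\<in>NCP L. (\<lambda>B. g ` B) ` P)"

definition rotation_group :: "nat \<Rightarrow> (nat \<Rightarrow> nat) monoid" where
  "rotation_group L = subgroup_generated (sym_group L) {rotation L}"

definition rotation_reflection_group :: "nat \<Rightarrow> (nat \<Rightarrow> nat) monoid" where
  "rotation_reflection_group L = subgroup_generated (sym_group L) {rotation L, reflection L}"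

section \<open>Numbers of equivalence classes\<close>

definition N_Z_tri_PF :: "nat \<Rightarrow> nat" where
  "N_Z_tri_PF L = card (orbits (rotation_group L) (NCP L) (partition_action L))"

definition N_Z_sq_PF :: "nat \<Rightarrow> nat" where
  "N_Z_sq_PF L = card (orbits (rotation_reflection_group L) (NCP L) (partition_action L))"

section \<open>The groups act on the non-crossing partitions\<close>

text \<open>
  \<^const>\<open>subgroup_generated\<close> silently drops generators outside the carrier, and
  \<^const>\<open>orbits\<close> does not require an action; the following facts exclude both pitfalls.
\<close>

lemma rotation_permutes: "rotation L permutes {1..L}"
proof (rule bij_imp_permutes)
  have inj: "inj_on (rotation L) {1..L}"
  proof (rule inj_onI)
    fix x y assume xy: "x \<in> {1..L}" "y \<in> {1..L}" "rotation L x = rotation L y"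
    then have e: "x mod L = y mod L" by (simp add: rotation_def)
    have "x mod L = (if x = L then 0 else x)" "y mod L = (if y = L then 0 else y)"
      using xy by auto
    with e xy show "x = y" by (auto split: if_splits)
  qed
  have "rotation L ` {1..L} \<subseteq> {1..L}"
    by (auto simp: rotation_def Suc_le_eq)
  then show "bij_betw (rotation L) {1..L} {1..L}"
    using inj by (simp add: bij_betw_def endo_inj_surj)
qed (auto simp: rotation_def)

lemma reflection_permutes: "reflection L permutes {1..L}"
proof (rule bij_imp_permutes)
  show "bij_betw (reflection L) {1..L} {1..L}"
    by (rule bij_betw_byWitness[where f' = "reflection L"]) (auto simp: reflection_def)
qed (auto simp: reflection_def)

lemma carrier_rotation_group:
  "carrier (rotation_group L) = generate (sym_group L) {rotation L}"
  using rotation_permutes[of L]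
  by (simp add: rotation_group_def carrier_subgroup_generated sym_group_carrier)

lemma carrier_rotation_reflection_group:
  "carrier (rotation_reflection_group L) = generate (sym_group L) {rotation L, reflection L}"
  using rotation_permutes[of L] reflection_permutes[of L]
  by (simp add: rotation_reflection_group_def carrier_subgroup_generated sym_group_carrier)

lemma partition_on_image:
  assumes "p permutes A" "partition_on A P"
  shows "partition_on A ((`) p ` P)"
proof (rule partition_onI)
  show "\<Union> ((`) p ` P) = A"
    using assms by (metis image_Union partition_onD1 permutes_image)
  show "{} \<notin> (`) p ` P" using assms(2) by (auto simp: partition_on_def)
next
  fix B C assume "B \<in> (`) p ` P" "C \<in> (`) p ` P" "B \<noteq> C"
  then obtain B' C' where BC: "B' \<in> P" "C' \<in> P" "B = p ` B'" "C = p ` C'" "B' \<noteq> C'"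
    by auto
  then have "disjnt B' C'"
    using assms(2) by (auto simp: partition_on_def pairwise_def)
  then show "disjnt B C"
    using BC permutes_inj[OF assms(1)] by (auto simp: disjnt_def inj_def)
qed

lemma noncrossingD:
  assumes "noncrossing P" "B \<in> P" "C \<in> P" "B \<noteq> C" "a \<in> B" "c \<in> B" "b \<in> C" "d \<in> C"
    "a < b" "b < c" "c < d"
  shows False
  using assms unfolding noncrossing_def by blast

lemma NCP_image_rotation:
  assumes "P \<in> NCP L"
  shows "(`) (rotation L) ` P \<in> NCP L"
proof -
  have P: "partition_on {1..L} P" "noncrossing P" using assms by (auto simp: NCP_def)
  have "noncrossing ((`) (rotation L) ` P)"
    unfolding noncrossing_def
  proof clarify
    fix a b c d B C x y z w
    assume h: "rotation L x < rotation L y" "rotation L y < rotation L z"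
      "rotation L z < rotation L w"
      "B \<in> P" "C \<in> P" "rotation L ` B \<noteq> rotation L ` C" "x \<in> B" "z \<in> B" "y \<in> C" "w \<in> C"
    have ne: "B \<noteq> C" using h by auto
    have s: "x \<in> {1..L}" "y \<in> {1..L}" "z \<in> {1..L}" "w \<in> {1..L}"
      using partition_onD1[OF P(1)] h by blast+
    have r: "rotation L i = (if i = L then 1 else i + 1)" if "i \<in> {1..L}" for i
      using that by (auto simp: rotation_def)
    have o: "y < z" "z < w" "x < y \<or> x = L"
      using h(1-3) s unfolding r[OF s(1)] r[OF s(2)] r[OF s(3)] r[OF s(4)]
      by (auto split: if_splits)
    show False
    proof (cases "x < y")
      case True
      then show False using noncrossingD[OF P(2), of B C x z y w] h ne o by auto
    next
      case False
      then have "x = L" using o by auto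
      moreover have "w \<noteq> x" using h(1-3) by auto
      ultimately have "w < x" using s(4) by simp
      then show False using noncrossingD[OF P(2), of C B y w z x] h ne o by auto
    qed
  qed
  then show ?thesis using partition_on_image[OF rotation_permutes P(1)] by (simp add: NCP_def)
qed

lemma NCP_image_reflection:
  assumes "P \<in> NCP L"
  shows "(`) (reflection L) ` P \<in> NCP L"
proof -
  have P: "partition_on {1..L} P" "noncrossing P" using assms by (auto simp: NCP_def)
  have "noncrossing ((`) (reflection L) ` P)"
    unfolding noncrossing_def
  proof clarify
    fix a b c d B C x y z w
    assume h: "reflection L x < reflection L y" "reflection L y < reflection L z"
      "reflection L z < reflection L w"
      "B \<in> P" "C \<in> P" "reflection L ` B \<noteq> reflection L ` C" "x \<in> B" "z \<in> B" "y \<in> C" "w \<in> C"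
    have ne: "B \<noteq> C" using h by auto
    have s: "x \<in> {1..L}" "y \<in> {1..L}" "z \<in> {1..L}" "w \<in> {1..L}"
      using partition_onD1[OF P(1)] h by blast+
    have "w < z" "z < y" "y < x"
      using h(1-3) s by (auto simp: reflection_def)
    then show False using noncrossingD[OF P(2), of C B w y z x] h ne by auto
  qed
  then show ?thesis using partition_on_image[OF reflection_permutes P(1)] by (simp add: NCP_def)
qed

lemma finite_NCP: "finite (NCP L)"
proof (rule finite_subset)
  show "NCP L \<subseteq> Pow (Pow {1..L})" by (auto simp: NCP_def partition_on_def)
qed simp

lemma bij_betw_NCP:
  assumes "p permutes {1..L}" "\<And>P. P \<in> NCP L \<Longrightarrow> (`) p ` P \<in> NCP L"
  shows "bij_betw (\<lambda>P. (`) p ` P) (NCP L) (NCP L)"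
proof -
  have "inj (\<lambda>P. (`) p ` P)"
    using permutes_inj[OF assms(1)] by (simp add: inj_image_eq_iff inj_def)
  then have "inj_on (\<lambda>P. (`) p ` P) (NCP L)" by (rule inj_on_subset) simp
  moreover have "(\<lambda>P. (`) p ` P) ` NCP L \<subseteq> NCP L" using assms(2) by auto
  ultimately show ?thesis by (simp add: bij_betw_def endo_inj_surj finite_NCP)
qed

lemma group_action_NCP:
  assumes S: "S \<subseteq> {rotation L, reflection L}"
  shows "group_action (subgroup_generated (sym_group L) S) (NCP L) (partition_action L)"
proof -
  interpret G: group "sym_group L" by (rule sym_group_is_group)
  let ?H = "subgroup_generated (sym_group L) S"
  have Ssub: "S \<subseteq> carrier (sym_group L)"
    using S rotation_permutes[of L] reflection_permutes[of L]
    by (auto simp: sym_group_carrier)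
  have c: "carrier ?H = generate (sym_group L) S"
    using Ssub by (simp add: carrier_subgroup_generated Int_absorb1)
  have perm: "p permutes {1..L}" if "p \<in> generate (sym_group L) S" for p
    using G.generate_in_carrier[OF Ssub that] by (simp add: sym_group_carrier)
  have im: "(`) p ` P \<in> NCP L" if "p \<in> generate (sym_group L) S" "P \<in> NCP L" for p P
    using that
  proof (induction arbitrary: P rule: generate.induct)
    case one
    then show ?case by (simp add: sym_group_one)
  next
    case (incl h)
    then show ?case using S NCP_image_rotation NCP_image_reflection by blast
  next
    case (inv h)
    have hp: "h permutes {1..L}" using inv Ssub by (auto simp: sym_group_carrier)
    have "bij_betw (\<lambda>P. (`) h ` P) (NCP L) (NCP L)"
      by (rule bij_betw_NCP[OF hp]) (use inv S NCP_image_rotation NCP_image_reflection in blast)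
    then obtain Q where Q: "Q \<in> NCP L" "P = (`) h ` Q"
      using inv.prems unfolding bij_betw_def by blast
    have "(inv\<^bsub>sym_group L\<^esub> h) \<circ> h = id"
      using G.l_inv[of h] hp by (simp add: sym_group_carrier sym_group_mult sym_group_one)
    then have "(inv\<^bsub>sym_group L\<^esub> h) (h x) = x" for x
      by (simp add: fun_eq_iff)
    then have "(`) (inv\<^bsub>sym_group L\<^esub> h) ` P = Q"
      using Q(2) by (simp add: image_image)
    then show ?case using Q by simp
  next
    case (eng h1 h2)
    then have "(`) h1 ` (`) h2 ` P \<in> NCP L" by blast
    then show ?case by (simp add: sym_group_mult image_image)
  qed
  have Bij: "partition_action L g \<in> Bij (NCP L)" if "g \<in> carrier ?H" for g
  proof -
    have "bij_betw (partition_action L g) (NCP L) (NCP L) \<longleftrightarrow>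
        bij_betw (\<lambda>P. (`) g ` P) (NCP L) (NCP L)"
      by (rule bij_betw_cong) (simp add: partition_action_def)
    moreover have "g \<in> generate (sym_group L) S" using that c by simp
    ultimately show ?thesis
      using bij_betw_NCP[OF perm im] by (simp add: Bij_def partition_action_def)
  qed
  have "partition_action L \<in> hom ?H (BijGroup (NCP L))"
  proof (rule homI)
    fix g h assume gh: "g \<in> carrier ?H" "h \<in> carrier ?H"
    show "partition_action L g \<in> carrier (BijGroup (NCP L))"
      using Bij[OF gh(1)] by (simp add: BijGroup_def)
    have "partition_action L (g \<circ> h) =
        compose (NCP L) (partition_action L g) (partition_action L h)"
    proof
      fix P
      show "partition_action L (g \<circ> h) P =
          compose (NCP L) (partition_action L g) (partition_action L h) P"
      proof (cases "P \<in> NCP L")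
        case True
        then have "(`) h ` P \<in> NCP L" using im[of h P] gh(2) c by simp
        then show ?thesis using True
          by (simp add: partition_action_def compose_def image_image)
      qed (simp add: partition_action_def compose_def)
    qed
    then show "partition_action L (g \<otimes>\<^bsub>?H\<^esub> h) =
        partition_action L g \<otimes>\<^bsub>BijGroup (NCP L)\<^esub> partition_action L h"
      using Bij[OF gh(1)] Bij[OF gh(2)] by (simp add: BijGroup_def sym_group_mult)
  qed
  then have "group_hom ?H (BijGroup (NCP L)) (partition_action L)"
    using G.group_subgroup_generated group_BijGroup
    by (simp add: group_hom_def group_hom_axioms_def)
  then show ?thesis by (simp add: group_action_def)
qed

corollary group_action_rotation_group:
  "group_action (rotation_group L) (NCP L) (partition_action L)"
  unfolding rotation_group_def by (rule group_action_NCP) simp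

corollary group_action_rotation_reflection_group:
  "group_action (rotation_reflection_group L) (NCP L) (partition_action L)"
  unfolding rotation_reflection_group_def by (rule group_action_NCP) simp

end

theory Submission
  imports Defs
begin

text \<open>
  A dihedral orbit is a rotation orbit together with its mirror image, so twice the number of
  dihedral orbits exceeds the number of rotation orbits by the number \<open>F\<close> of rotation orbits that are
  stable under the reflection. Double counting shows that \<open>L * F\<close> is the total number of fixed points
  of the \<open>L\<close> reflections, so it suffices that every reflection fixes \<open>L choose (L div 2)\<close>
  non-crossing partitions.

  A partition fixed by a reflection is determined by its restriction to one side of the axis and
  the set of blocks that cross the axis. Such half partitions are built vertex by vertex: a new vertex
  forms its own block or joins the marked block nearest to the axis, and the resulting block is
  marked or not. This yields the recursion of ballot numbers, whose sums are central binomial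
  coefficients. The boundary conditions for vertices on the axis only ask that the first or the last
  vertex lies in a marked block.
\<close>

section \<open>Half partitions with marked blocks\<close>

text \<open>Exposed blocks follow one another from left to right without overlap. A new vertex may
  join only the last marked one, because joining an earlier one would enclose those behind it.
  Joining is therefore a yes/no choice, available as soon as some block is marked, and this is why
  the recursion depends only on the number of marks. Vertices on the axis are the delicate point:
  the block of such a vertex is its own mirror image and must be marked. Up to conjugation by
  rotations there are at most two reflections. For \<open>L = 2 * m\<close> one axis avoids all
  vertices and leaves every half partition of \<open>m\<close> vertices, while the other passes
  through two vertices and asks for \<open>m + 1\<close> vertices with both ends marked. For
  \<open>L = 2 * m + 1\<close> the axis passes through one vertex, and the two ways of cutting the
  circuit put it last or first among \<open>m + 1\<close> vertices. All these counts turn out to be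
  the same central binomial coefficient.\<close>

lemma NCP_block_unique:
  "P \<in> NCP n \<Longrightarrow> B \<in> P \<Longrightarrow> C \<in> P \<Longrightarrow> x \<in> B \<Longrightarrow> x \<in> C \<Longrightarrow> B = C"
  unfolding NCP_def partition_on_def disjoint_def by blast

lemma NCP_block_exists: "P \<in> NCP n \<Longrightarrow> x \<in> {1..n} \<Longrightarrow> \<exists>B\<in>P. x \<in> B"
  unfolding NCP_def partition_on_def by blast

lemma NCP_block_subset: "P \<in> NCP n \<Longrightarrow> B \<in> P \<Longrightarrow> B \<subseteq> {1..n}"
  unfolding NCP_def partition_on_def by blast

lemma NCP_block_nonempty: "P \<in> NCP n \<Longrightarrow> B \<in> P \<Longrightarrow> B \<noteq> {}"
  unfolding NCP_def partition_on_def by blast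

lemma NCP_noncrossing: "P \<in> NCP n \<Longrightarrow> noncrossing P"
  by (simp add: NCP_def)

lemma NCPI:
  assumes "\<And>B x. B \<in> P \<Longrightarrow> x \<in> B \<Longrightarrow> x \<in> {1..n}"
    and "\<And>x. x \<in> {1..n} \<Longrightarrow> \<exists>B\<in>P. x \<in> B"
    and "\<And>B C x. B \<in> P \<Longrightarrow> C \<in> P \<Longrightarrow> x \<in> B \<Longrightarrow> x \<in> C \<Longrightarrow> B = C"
    and "{} \<notin> P"
    and "\<And>B C a b c d. B \<in> P \<Longrightarrow> C \<in> P \<Longrightarrow> B \<noteq> C \<Longrightarrow> a \<in> B \<Longrightarrow> b \<in> C \<Longrightarrow> c \<in> B \<Longrightarrow>
      d \<in> C \<Longrightarrow> a < b \<Longrightarrow> b < c \<Longrightarrow> c < d \<Longrightarrow> False"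
  shows "P \<in> NCP n"
proof -
  have "partition_on {1..n} P"
    by (rule partition_onI) (use assms(1-4) in \<open>auto simp: disjnt_def\<close>, blast+)
  moreover have "noncrossing P"
    unfolding noncrossing_def using assms(5) by blast
  ultimately show ?thesis by (simp add: NCP_def)
qed

text \<open>These are the outer blocks of a non-crossing partition. The empty set qualifies
  vacuously, so \<open>adjoin_in\<close> can treat a missing block \<open>T = {}\<close> like an
  exposed one.\<close>

definition exposed :: "nat set \<Rightarrow> nat set set \<Rightarrow> bool" where
  "exposed A P \<longleftrightarrow> (\<forall>C\<in>P. C \<noteq> A \<longrightarrow> (\<forall>c\<in>C. \<forall>d\<in>C. \<forall>a\<in>A. \<not> (c < a \<and> a < d)))"

lemma exposedD:
  "exposed A P \<Longrightarrow> C \<in> P \<Longrightarrow> C \<noteq> A \<Longrightarrow> c \<in> C \<Longrightarrow> d \<in> C \<Longrightarrow> a \<in> A \<Longrightarrow> c < a \<Longrightarrow> a < d \<Longrightarrow> False"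
  unfolding exposed_def by blast

text \<open>
  The left half of a partition that is symmetric under a reflection: \<open>M\<close> marks the blocks that
  continue across the axis, which lies to the right of \<open>m\<close>. A marked block is not enclosed by
  another block, since its continuation would cross it.
\<close>

definition open_NCP :: "nat \<Rightarrow> (nat set set \<times> nat set set) set" where
  "open_NCP m = {(P, M). P \<in> NCP m \<and> M \<subseteq> P \<and> (\<forall>A\<in>M. exposed A P)}"

lemma finite_open_NCP: "finite (open_NCP m)"
proof (rule finite_subset)
  show "open_NCP m \<subseteq> Pow (Pow {1..m}) \<times> Pow (Pow {1..m})"
    unfolding open_NCP_def using NCP_block_subset by blast
qed simp

definition top_block :: "nat set set \<Rightarrow> nat set \<Rightarrow> bool" where
  "top_block M T \<longleftrightarrow> T \<in> M \<and> (\<forall>A\<in>M. A \<noteq> T \<longrightarrow> (\<forall>a\<in>A. \<forall>t\<in>T. a < t))"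

lemma top_block_unique:
  assumes "(P, M) \<in> open_NCP m" "top_block M T" "top_block M T'"
  shows "T = T'"
proof (rule ccontr)
  assume ne: "T \<noteq> T'"
  have "T \<in> P" "T' \<in> P" "P \<in> NCP m"
    using assms by (auto simp: top_block_def open_NCP_def)
  then obtain t t' where "t \<in> T" "t' \<in> T'"
    using NCP_block_nonempty[of P m] by (meson ex_in_conv)
  then have "t < t'" "t' < t"
    using assms(2,3) ne unfolding top_block_def by auto
  then show False by simp
qed

text \<open>The block \<open>T\<close> with the largest marked vertex works: a vertex of another
  marked block beyond some \<open>t\<close> in \<open>T\<close> would lie between \<open>t\<close>
  and that largest vertex, so \<open>T\<close> would enclose an exposed block.\<close>

lemma top_block_exists:
  assumes "(P, M) \<in> open_NCP m" "M \<noteq> {}"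
  shows "\<exists>T. top_block M T"
proof -
  have P: "P \<in> NCP m" "M \<subseteq> P" and ex: "\<And>A. A \<in> M \<Longrightarrow> exposed A P"
    using assms(1) by (auto simp: open_NCP_def)
  have fin: "finite (\<Union>M)"
    using P NCP_block_subset by (intro finite_subset[of "\<Union>M" "{1..m}"]) blast+
  have "\<Union>M \<noteq> {}" using assms(2) P NCP_block_nonempty by blast
  then have "Max (\<Union>M) \<in> \<Union>M" using fin by (rule Max_in[rotated])
  then obtain T where T: "T \<in> M" "Max (\<Union>M) \<in> T" by blast
  have "a < t" if A: "A \<in> M" "A \<noteq> T" "a \<in> A" "t \<in> T" for A a t
  proof (rule ccontr)
    assume "\<not> a < t"
    moreover have "a \<noteq> t" "a \<noteq> Max (\<Union>M)"
      using NCP_block_unique[OF P(1), of A T a] A P(2) T by blast+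
    moreover have "a \<le> Max (\<Union>M)" using A fin by (intro Max_ge) blast+
    ultimately have "t < a" "a < Max (\<Union>M)" by auto
    then show False using exposedD[OF ex[OF A(1)], of T t "Max (\<Union>M)" a] T A P(2) by blast
  qed
  then show ?thesis using T(1) unfolding top_block_def by blast
qed

section \<open>Adding and removing the largest vertex\<close>

text \<open>
  Removing the largest vertex \<open>n\<close> loses two pieces of information: the rest \<open>T\<close> of its block, which
  becomes marked (\<open>T = {}\<close> if the block was \<open>{n}\<close>), and whether that block was marked.
\<close>

definition adjoin :: "nat \<Rightarrow> nat set set \<Rightarrow> nat set set \<Rightarrow> nat set \<Rightarrow> bool \<Rightarrow> nat set set \<times> nat set set" where
  "adjoin n P M T b =
     (insert (insert n T) (P - {T}), (M - {T}) \<union> (if b then {insert n T} else {}))"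

text \<open>Extending \<open>T\<close> by the largest vertex creates no crossing because no other
  block encloses a vertex of \<open>T\<close>. The longer block does not enclose the remaining
  marked blocks, since they lie entirely to the left of \<open>T\<close>.\<close>

lemma adjoin_in:
  assumes "(P, M) \<in> open_NCP m" "T = {} \<or> top_block M T"
  shows "adjoin (Suc m) P M T b \<in> open_NCP (Suc m)"
proof -
  have P: "P \<in> NCP m" and M: "M \<subseteq> P" and ex: "\<And>A. A \<in> M \<Longrightarrow> exposed A P"
    using assms(1) by (auto simp: open_NCP_def)
  have T: "T = {} \<or> T \<in> M" using assms(2) by (auto simp: top_block_def)
  have exT: "exposed T P" using T
  proof
    assume "T = {}"
    then show ?thesis by (simp add: exposed_def)
  qed (rule ex)
  have sub: "x \<in> {1..m}" if "A \<in> P" "x \<in> A" for A x using NCP_block_subset[OF P] that by blast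
  have Tm: "x \<in> {1..m}" if "x \<in> T" for x using T M sub that by blast
  have less: "x < Suc m" if "A \<in> P" "x \<in> A" for A x using sub[OF that] by simp
  have TP: "A \<in> P - {T} \<Longrightarrow> x \<in> A \<Longrightarrow> x \<in> T \<Longrightarrow> False" for A x
    using T M NCP_block_unique[OF P, of A T x] by blast
  let ?B = "insert (Suc m) T"
  let ?P = "insert ?B (P - {T})"
  have NP: "?P \<in> NCP (Suc m)"
  proof (rule NCPI)
    fix B x assume "B \<in> ?P" "x \<in> B"
    then show "x \<in> {1..Suc m}" using sub[of B x] Tm by fastforce
  next
    fix x assume "x \<in> {1..Suc m}"
    then show "\<exists>B\<in>?P. x \<in> B"
      using NCP_block_exists[OF P, of x] by (cases "x = Suc m") auto
  next
    fix B C x assume "B \<in> ?P" "C \<in> ?P" "x \<in> B" "x \<in> C"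
    then show "B = C"
      using NCP_block_unique[OF P, of B C x] TP less[of B "Suc m"] less[of C "Suc m"] by blast
  next
    show "{} \<notin> ?P" using NCP_block_nonempty[OF P] by blast
  next
    fix B C w x y z
    assume h: "B \<in> ?P" "C \<in> ?P" "B \<noteq> C" "w \<in> B" "x \<in> C" "y \<in> B" "z \<in> C" "w < x" "x < y" "y < z"
    have zm: "z \<le> Suc m" using h(2,7) sub Tm by fastforce
    consider (1) "B = ?B" "C \<in> P" "C \<noteq> T" | (2) "C = ?B" "B \<in> P" "B \<noteq> T" | (3) "B \<in> P" "C \<in> P"
      using h by blast
    then show False
    proof cases
      case 1
      then have "y \<in> T" using h zm by auto
      then show False using exposedD[OF exT, of C x z y] 1 h by blast
    next
      case 2
      have "y < Suc m" using less[of B y] 2 h by blast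
      then have "x \<in> T" using 2 h by auto
      then show False using exposedD[OF exT, of B w y x] 2 h by blast
    next
      case 3
      then show False
        using noncrossingD[OF NCP_noncrossing[OF P], of B C w y x z] h by blast
    qed
  qed
  have exB: "exposed ?B ?P"
    unfolding exposed_def
  proof (intro ballI impI notI)
    fix C c d a assume h: "C \<in> ?P" "C \<noteq> ?B" "c \<in> C" "d \<in> C" "a \<in> ?B" "c < a \<and> a < d"
    then have C: "C \<in> P" "C \<noteq> T" by auto
    then have "a \<in> T" using less[of C d] h by auto
    then show False using exposedD[OF exT, of C c d a] C h by blast
  qed
  have exA: "exposed A ?P" if A: "A \<in> M" "A \<noteq> T" for A
    unfolding exposed_def
  proof (intro ballI impI notI)
    fix C c d a assume h: "C \<in> ?P" "C \<noteq> A" "c \<in> C" "d \<in> C" "a \<in> A" "c < a \<and> a < d"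
    show False
    proof (cases "C = ?B")
      case True
      have "a < Suc m" using less[of A a] A h M by blast
      then have "c \<in> T" using True h by auto
      moreover from this have "top_block M T" using assms(2) by blast
      ultimately have "a < c" using A h(5) unfolding top_block_def by blast
      then show False using h(6) by simp
    next
      case False
      then show False using exposedD[OF ex[OF A(1)], of C c d a] h by blast
    qed
  qed
  let ?M = "M - {T} \<union> (if b then {?B} else {})"
  have "A = ?B \<or> A \<in> M \<and> A \<noteq> T" if "A \<in> ?M" for A
    using that by (auto split: if_splits)
  then have "\<forall>A\<in>?M. exposed A ?P" "?M \<subseteq> ?P" using exA exB M by blast+
  then show ?thesis using NP unfolding open_NCP_def adjoin_def by simp
qed

text \<open>Let \<open>T\<close> be the rest of the block \<open>B\<close> of \<open>Suc m\<close>.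
  A block enclosing a vertex of \<open>T\<close> would cross \<open>B\<close> at
  \<open>Suc m\<close>, so \<open>T\<close> may be marked. A marked block with a vertex to the right
  of some vertex of \<open>T\<close> would be enclosed by \<open>B\<close>, so \<open>T\<close> is
  the top block.\<close>

lemma adjoin_surj:
  assumes "(P', M') \<in> open_NCP (Suc m)"
  shows "\<exists>P M T b. (P, M) \<in> open_NCP m \<and> (T = {} \<or> top_block M T) \<and> (P', M') = adjoin (Suc m) P M T b"
proof -
  have P': "P' \<in> NCP (Suc m)" and M': "M' \<subseteq> P'" and ex: "\<And>A. A \<in> M' \<Longrightarrow> exposed A P'"
    using assms(1) by (auto simp: open_NCP_def)
  obtain B where B: "B \<in> P'" "Suc m \<in> B" using NCP_block_exists[OF P', of "Suc m"] by auto
  define T where "T = B - {Suc m}"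
  \<comment> \<open>\<open>{T} - {{}}\<close> contributes \<open>T\<close> only if it is nonempty,
    so a singleton block disappears altogether.\<close>
  define P where "P = (P' - {B}) \<union> ({T} - {{}})"
  define M where "M = (M' - {B}) \<union> ({T} - {{}})"
  have sub: "x \<in> {1..Suc m}" if "A \<in> P'" "x \<in> A" for A x using NCP_block_subset[OF P'] that by blast
  have other: "x \<in> {1..m}" if "A \<in> P'" "A \<noteq> B" "x \<in> A" for A x
    using sub[of A x] NCP_block_unique[OF P' _ B(1), of A "Suc m"] B that by (cases "x = Suc m") auto
  have Tm: "x \<in> {1..m}" if "x \<in> T" for x using sub[OF B(1), of x] that by (auto simp: T_def)
  have TB: "T \<subseteq> B" "B = insert (Suc m) T" using B by (auto simp: T_def)
  have disj: "A \<in> P' \<Longrightarrow> A \<noteq> B \<Longrightarrow> x \<in> A \<Longrightarrow> x \<in> T \<Longrightarrow> False" for A x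
    using NCP_block_unique[OF P' _ B(1), of A x] TB by blast
  have TnP: "T \<notin> P' - {B}" using disj[of T] NCP_block_nonempty[OF P', of T] by blast
  have lift: "\<exists>B'\<in>P'. A \<subseteq> B' \<and> (B' = B \<longleftrightarrow> A = T)" if "A \<in> P" for A
    using that TnP TB B unfolding P_def by blast
  have PN: "P \<in> NCP m"
  proof (rule NCPI)
    fix A x assume "A \<in> P" "x \<in> A"
    then show "x \<in> {1..m}" using other[of A x] Tm by (auto simp: P_def)
  next
    fix x assume x: "x \<in> {1..m}"
    then obtain A where "A \<in> P'" "x \<in> A" using NCP_block_exists[OF P', of x] by auto
    moreover have "x \<noteq> Suc m" using x by auto
    ultimately show "\<exists>A\<in>P. x \<in> A" unfolding P_def T_def by (cases "A = B") auto
  next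
    fix A C x assume "A \<in> P" "C \<in> P" "x \<in> A" "x \<in> C"
    then show "A = C" using disj NCP_block_unique[OF P', of A C x] unfolding P_def by blast
  next
    show "{} \<notin> P" using NCP_block_nonempty[OF P'] by (auto simp: P_def)
  next
    fix A C w x y z
    assume h: "A \<in> P" "C \<in> P" "A \<noteq> C" "w \<in> A" "x \<in> C" "y \<in> A" "z \<in> C" "w < x" "x < y" "y < z"
    obtain A' where A': "A' \<in> P'" "A \<subseteq> A'" "A' = B \<longleftrightarrow> A = T" using lift[OF h(1)] by blast
    obtain C' where C': "C' \<in> P'" "C \<subseteq> C'" "C' = B \<longleftrightarrow> C = T" using lift[OF h(2)] by blast
    have "A' \<noteq> C'" using A' C' h(1-3) unfolding P_def
      by (metis DiffD1 NCP_block_unique[OF P'] UnE h(4,5) singletonD subsetD)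
    then show False
      using noncrossingD[OF NCP_noncrossing[OF P'], of A' C' w y x z] A' C' h by blast
  qed
  have exT: "exposed T P"
    unfolding exposed_def
  proof (intro ballI impI notI)
    fix C c d a assume h: "C \<in> P" "C \<noteq> T" "c \<in> C" "d \<in> C" "a \<in> T" "c < a \<and> a < d"
    then have C: "C \<in> P'" "C \<noteq> B" by (auto simp: P_def)
    have "d < Suc m" using other[OF C h(4)] by simp
    then show False
      using noncrossingD[OF NCP_noncrossing[OF P'], of C B c d a "Suc m"] C B h TB by blast
  qed
  have exA: "exposed A P" if A: "A \<in> M'" "A \<noteq> B" for A
    unfolding exposed_def
  proof (intro ballI impI notI)
    fix C c d a assume h: "C \<in> P" "C \<noteq> A" "c \<in> C" "d \<in> C" "a \<in> A" "c < a \<and> a < d"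
    show False
    proof (cases "C = T")
      case True
      then show False using exposedD[OF ex[OF A(1)], of B c d a] A h TB B by blast
    next
      case False
      then show False using exposedD[OF ex[OF A(1)], of C c d a] h by (auto simp: P_def)
    qed
  qed
  have "(P, M) \<in> open_NCP m"
    using PN M' exT exA by (auto simp: open_NCP_def M_def P_def)
  moreover have "top_block M T" if "T \<noteq> {}"
    unfolding top_block_def
  proof (intro conjI ballI impI)
    show "T \<in> M" using that by (simp add: M_def)
    fix A a t assume h: "A \<in> M" "A \<noteq> T" "a \<in> A" "t \<in> T"
    then have A: "A \<in> M'" "A \<noteq> B" "A \<in> P'" using M' by (auto simp: M_def)
    show "a < t"
    proof (rule ccontr)
      assume "\<not> a < t"
      moreover have "a \<noteq> t" using disj[of A a] A h by blast
      moreover have "a < Suc m" using other[of A a] A h by simp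
      ultimately show False
        using exposedD[OF ex[OF A(1)], of B t "Suc m" a] A h B TB by auto
    qed
  qed
  moreover have "(P', M') = adjoin (Suc m) P M T (B \<in> M')"
    using TnP B TB M' by (auto simp: adjoin_def P_def M_def)
  ultimately show ?thesis by blast
qed

text \<open>All data can be read off: the only block containing \<open>Suc m\<close> gives
  \<open>T\<close>, its mark gives \<open>b\<close>, and \<open>T\<close> belongs to the old blocks
  and to the old marks exactly if it is nonempty.\<close>

lemma adjoin_inj:
  assumes "(P, M) \<in> open_NCP m" "T = {} \<or> top_block M T"
    and "(P', M') \<in> open_NCP m" "T' = {} \<or> top_block M' T'"
    and eq: "adjoin (Suc m) P M T b = adjoin (Suc m) P' M' T' b'"
  shows "P = P' \<and> M = M' \<and> T = T' \<and> b = b'"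
proof -
  have *: "Suc m \<notin> A" if "A \<in> P \<or> A \<in> P'" for A
    using that assms(1,3) NCP_block_subset[of P m] NCP_block_subset[of P' m]
    by (fastforce simp: open_NCP_def)
  have M: "M \<subseteq> P" "M' \<subseteq> P'" "{} \<notin> P" "{} \<notin> P'"
    using assms(1,3) NCP_block_nonempty by (auto simp: open_NCP_def)
  have T: "T = {} \<or> T \<in> M" "T' = {} \<or> T' \<in> M'"
    using assms(2,4) by (auto simp: top_block_def)
  then have nT: "Suc m \<notin> T" "Suc m \<notin> T'" using * M by blast+
  have eq1: "insert (insert (Suc m) T) (P - {T}) = insert (insert (Suc m) T') (P' - {T'})"
    and eq2: "M - {T} \<union> (if b then {insert (Suc m) T} else {}) =
      M' - {T'} \<union> (if b' then {insert (Suc m) T'} else {})"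
    using eq by (auto simp: adjoin_def)
  have B: "insert (Suc m) T \<notin> P" "insert (Suc m) T \<notin> P'"
    "insert (Suc m) T' \<notin> P" "insert (Suc m) T' \<notin> P'"
    using * by blast+
  have "insert (Suc m) T \<in> insert (insert (Suc m) T') (P' - {T'})"
    unfolding eq1[symmetric] by simp
  then have "insert (Suc m) T = insert (Suc m) T'" using B by simp
  then have TT: "T = T'" using nT by (simp add: insert_ident)
  have PP: "P - {T} = P' - {T}" using eq1 B unfolding TT[symmetric] by (simp add: insert_ident)
  have MB: "insert (Suc m) T \<notin> M" "insert (Suc m) T \<notin> M'" using B M by blast+
  have bb: "b = b'"
  proof -
    have "b \<longleftrightarrow> insert (Suc m) T \<in> M - {T} \<union> (if b then {insert (Suc m) T} else {})"
      using MB by simp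
    also have "\<dots> \<longleftrightarrow> b'" unfolding eq2 TT[symmetric] using MB by simp
    finally show ?thesis .
  qed
  have MM: "M - {T} = M' - {T}"
    using eq2 MB unfolding TT[symmetric] bb by (cases b') (simp_all add: insert_ident)
  have "T \<in> M \<longleftrightarrow> T \<in> M'" "T \<in> P \<longleftrightarrow> T \<in> P'"
    using T M unfolding TT[symmetric] by auto
  then have "P = P'" "M = M'" using PP MM by auto
  then show ?thesis using TT bb by simp
qed

section \<open>Ballot numbers\<close>

text \<open>Encodes the choice of \<open>T\<close> as a bit, so that extensions are indexed by two
  bits independent of the partition. The definite description is meaningful only if some block is
  marked, whence the recurring condition \<open>c \<longrightarrow> M \<noteq> {}\<close>.\<close>

definition attach :: "nat set set \<Rightarrow> bool \<Rightarrow> nat set" where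
  "attach M c = (if c then THE T. top_block M T else {})"

lemma attach:
  assumes "(P, M) \<in> open_NCP m" "c \<longrightarrow> M \<noteq> {}"
  shows "attach M c = {} \<or> top_block M (attach M c)" "attach M c \<noteq> {} \<longleftrightarrow> c"
    "attach M c \<in> M \<longleftrightarrow> c" "Suc m \<notin> attach M c"
proof -
  have P: "P \<in> NCP m" "M \<subseteq> P" using assms(1) by (auto simp: open_NCP_def)
  have "top_block M (attach M c)" if c: c
  proof -
    obtain T where T: "top_block M T" using top_block_exists[OF assms(1)] assms(2) c by blast
    have "(THE T. top_block M T) = T"
      by (rule the_equality[where P = "top_block M", OF T]) (rule top_block_unique[OF assms(1) _ T])
    then show ?thesis using T c by (simp add: attach_def)
  qed
  then have *: "(c \<longrightarrow> top_block M (attach M c) \<and> attach M c \<in> M) \<and> (\<not> c \<longrightarrow> attach M c = {})"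
    by (simp add: attach_def top_block_def)
  have ne: "{} \<notin> M" using NCP_block_nonempty P by blast
  have "A \<subseteq> {1..m}" if "A \<in> M" for A using NCP_block_subset[OF P(1)] P(2) that by blast
  then have "A \<in> M \<Longrightarrow> Suc m \<notin> A" for A by fastforce
  then show "attach M c = {} \<or> top_block M (attach M c)" "attach M c \<noteq> {} \<longleftrightarrow> c"
    "attach M c \<in> M \<longleftrightarrow> c" "Suc m \<notin> attach M c"
    using * ne by (cases c; metis empty_iff)+
qed

lemma bij_betw_adjoin:
  "bij_betw (\<lambda>((c, b), (P, M)). adjoin (Suc m) P M (attach M c) b)
     (SIGMA cb:UNIV. {p \<in> open_NCP m. fst cb \<longrightarrow> snd p \<noteq> {}}) (open_NCP (Suc m))"
  (is "bij_betw ?f ?S _")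
  unfolding bij_betw_def
proof
  show "inj_on ?f ?S"
  proof (rule inj_onI)
    fix x y assume xy: "x \<in> ?S" "y \<in> ?S" "?f x = ?f y"
    obtain c b P M c' b' P' M' where e: "x = ((c, b), P, M)" "y = ((c', b'), P', M')"
      by (metis surj_pair)
    have x: "(P, M) \<in> open_NCP m" "c \<longrightarrow> M \<noteq> {}" and y: "(P', M') \<in> open_NCP m" "c' \<longrightarrow> M' \<noteq> {}"
      using xy e by auto
    have "adjoin (Suc m) P M (attach M c) b = adjoin (Suc m) P' M' (attach M' c') b'"
      using xy(3) e by simp
    then have "P = P' \<and> M = M' \<and> attach M c = attach M' c' \<and> b = b'"
      by (rule adjoin_inj[OF x(1) attach(1)[OF x] y(1) attach(1)[OF y]])
    then show "x = y" using attach(2)[OF x] attach(2)[OF y] e by auto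
  qed
  show "?f ` ?S = open_NCP (Suc m)"
  proof
    show "?f ` ?S \<subseteq> open_NCP (Suc m)"
    proof
      fix y assume "y \<in> ?f ` ?S"
      then obtain x where x: "x \<in> ?S" "y = ?f x" by blast
      obtain c b P M where "x = ((c, b), P, M)" by (metis surj_pair)
      then have h: "(P, M) \<in> open_NCP m" "c \<longrightarrow> M \<noteq> {}" "y = adjoin (Suc m) P M (attach M c) b"
        using x by auto
      show "y \<in> open_NCP (Suc m)" unfolding h(3) by (rule adjoin_in[OF h(1) attach(1)[OF h(1,2)]])
    qed
    show "open_NCP (Suc m) \<subseteq> ?f ` ?S"
    proof
      fix y assume "y \<in> open_NCP (Suc m)"
      then obtain P M T b where h: "(P, M) \<in> open_NCP m" "T = {} \<or> top_block M T"
        "y = adjoin (Suc m) P M T b"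
        using adjoin_surj[of "fst y" "snd y"] by (metis prod.collapse)
      define c where "c \<longleftrightarrow> T \<noteq> {}"
      have M: "c \<longrightarrow> M \<noteq> {}" using h(2) by (auto simp: c_def top_block_def)
      have "T = attach M c"
        using attach(1,2)[OF h(1) M] h(2) top_block_unique[OF h(1)] unfolding c_def by metis
      then have "y = ?f ((c, b), (P, M))" using h by simp
      moreover have "((c, b), (P, M)) \<in> ?S" using h M by simp
      ultimately show "y \<in> ?f ` ?S" by (rule image_eqI)
    qed
  qed
qed

text \<open>The predicate \<open>R\<close> is kept general so that the same decomposition serves the
  number of marks and the boundary conditions at the first and last vertex.\<close>

lemma card_open_NCP_Suc:
  "card {y \<in> open_NCP (Suc m). R y} =
    (\<Sum>c\<in>UNIV. \<Sum>b\<in>UNIV. card {(P, M) \<in> open_NCP m. (c \<longrightarrow> M \<noteq> {}) \<and> R (adjoin (Suc m) P M (attach M c) b)})"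
  (is "_ = (\<Sum>c\<in>UNIV. \<Sum>b\<in>UNIV. card (?A c b))")
proof -
  let ?f = "\<lambda>((c, b), (P, M)). adjoin (Suc m) P M (attach M c) b"
  let ?S = "SIGMA cb:UNIV. {p \<in> open_NCP m. fst cb \<longrightarrow> snd p \<noteq> {}}"
  have inj: "inj_on ?f ?S" and im: "?f ` ?S = open_NCP (Suc m)"
    using bij_betw_adjoin[of m] by (simp_all add: bij_betw_def)
  have "{y \<in> open_NCP (Suc m). R y} = ?f ` {x \<in> ?S. R (?f x)}"
    unfolding im[symmetric] by blast
  then have "card {y \<in> open_NCP (Suc m). R y} = card {x \<in> ?S. R (?f x)}"
    by (simp only: card_image[OF inj_on_subset[OF inj Collect_restrict]])
  also have "{x \<in> ?S. R (?f x)} = (SIGMA cb:UNIV. ?A (fst cb) (snd cb))" by auto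
  also have "card \<dots> = (\<Sum>cb\<in>UNIV. card (?A (fst cb) (snd cb)))"
  proof (rule card_SigmaI)
    have "finite (?A c b)" for c b
      by (rule finite_subset[OF _ finite_open_NCP[of m]]) auto
    then show "\<forall>cb\<in>UNIV. finite (?A (fst cb) (snd cb))" by blast
  qed simp
  also have "\<dots> = (\<Sum>c\<in>UNIV. \<Sum>b\<in>UNIV. card (?A c b))"
    unfolding sum.cartesian_product UNIV_Times_UNIV by (simp add: case_prod_unfold)
  finally show ?thesis .
qed

text \<open>Joining uses up the mark of the top block, and \<open>b\<close> creates a new one. The
  equation is additive to avoid truncated subtraction.\<close>

lemma card_adjoin:
  assumes "(P, M) \<in> open_NCP m" "c \<longrightarrow> M \<noteq> {}"
  shows "card (snd (adjoin (Suc m) P M (attach M c) b)) + of_bool c = card M + of_bool b"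
proof -
  have P: "P \<in> NCP m" "M \<subseteq> P" using assms(1) by (auto simp: open_NCP_def)
  have sub: "A \<subseteq> {1..m}" if "A \<in> M" for A using NCP_block_subset[OF P(1)] P(2) that by blast
  then have fin: "finite M" by (intro finite_subset[of M "Pow {1..m}"]) auto
  have "insert (Suc m) (attach M c) \<notin> M" using sub by fastforce
  then have "card (snd (adjoin (Suc m) P M (attach M c) b)) = card (M - {attach M c}) + of_bool b"
    using fin by (cases b) (auto simp: adjoin_def)
  moreover have "card (M - {attach M c}) + of_bool c = card M"
  proof (cases c)
    case True
    then have "attach M c \<in> M" using attach(3)[OF assms] by simp
    then show ?thesis using card_Suc_Diff1[OF fin, of "attach M c"] True by simp
  qed (use attach(3)[OF assms] in simp)
  ultimately show ?thesis by simp
qed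

text \<open>No old block contains \<open>Suc m\<close>, so its mark is decided by \<open>b\<close>
  alone. If the new block is marked, the vertices of \<open>T\<close> merely move from one marked
  block into another.\<close>

lemma Union_adjoin:
  assumes "(P, M) \<in> open_NCP m" "c \<longrightarrow> M \<noteq> {}"
  shows "Suc m \<in> \<Union>(snd (adjoin (Suc m) P M (attach M c) b)) \<longleftrightarrow> b"
    and "x \<in> {1..m} \<Longrightarrow> b \<Longrightarrow> x \<in> \<Union>(snd (adjoin (Suc m) P M (attach M c) b)) \<longleftrightarrow> x \<in> \<Union>M"
proof -
  have P: "P \<in> NCP m" "M \<subseteq> P" using assms(1) by (auto simp: open_NCP_def)
  have sub: "A \<subseteq> {1..m}" if "A \<in> M" for A using NCP_block_subset[OF P(1)] P(2) that by blast
  then have "Suc m \<notin> A" if "A \<in> M" for A using that by fastforce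
  then show "Suc m \<in> \<Union>(snd (adjoin (Suc m) P M (attach M c) b)) \<longleftrightarrow> b"
    by (auto simp: adjoin_def)
  assume "x \<in> {1..m}" "b"
  moreover have "attach M c \<in> M \<or> attach M c = {}" using attach(2,3)[OF assms] by blast
  ultimately show "x \<in> \<Union>(snd (adjoin (Suc m) P M (attach M c) b)) \<longleftrightarrow> x \<in> \<Union>M"
    by (auto simp: adjoin_def)
qed

text \<open>
  \<open>adjoin\<close> changes the number of marked blocks like two steps of a path that stays nonnegative, so
  \<open>ballot m j\<close> counts such paths of length \<open>2 * m\<close> ending at height \<open>2 * j\<close>.
\<close>

definition ballot :: "nat \<Rightarrow> nat \<Rightarrow> nat" where
  "ballot m j = card {p \<in> open_NCP m. card (snd p) = j}"

lemma finite_open_blocks: "(P, M) \<in> open_NCP m \<Longrightarrow> finite M"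
  by (rule finite_subset[of M "Pow {1..m}"]) (use NCP_block_subset in \<open>fastforce simp: open_NCP_def\<close>)+

text \<open>The summands are the choices of \<open>(c, b)\<close>: neither or both keep the number
  of marks, joining alone lowers it, marking alone raises it. For \<open>j = 0\<close> the two
  choices with \<open>b\<close> are impossible, as they leave a marked block.\<close>

lemma ballot_Suc:
  "ballot (Suc m) j = ballot m j + ballot m (Suc j) +
     (case j of 0 \<Rightarrow> 0 | Suc i \<Rightarrow> ballot m i + ballot m j)"
proof -
  let ?A = "\<lambda>c b. {(P, M) \<in> open_NCP m. (c \<longrightarrow> M \<noteq> {}) \<and>
    card (snd (adjoin (Suc m) P M (attach M c) b)) = j}"
  have *: "?A c b = {p \<in> open_NCP m. (c \<longrightarrow> snd p \<noteq> {}) \<and> card (snd p) + of_bool b = j + of_bool c}" for c b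
    using card_adjoin[of _ _ m c b] by fastforce
  have e: "card (snd p) = 0 \<longleftrightarrow> snd p = {}" if "p \<in> open_NCP m" for p
    using finite_open_blocks[of "fst p" "snd p" m] that by simp
  have FF: "?A False False = {p \<in> open_NCP m. card (snd p) = j}" unfolding * by simp
  have TF: "?A True False = {p \<in> open_NCP m. card (snd p) = Suc j}" unfolding * using e by auto
  have FT: "?A False True = (case j of 0 \<Rightarrow> {} | Suc i \<Rightarrow> {p \<in> open_NCP m. card (snd p) = i})"
    unfolding * by (auto split: nat.split)
  have TT: "?A True True = (case j of 0 \<Rightarrow> {} | Suc i \<Rightarrow> {p \<in> open_NCP m. card (snd p) = Suc i})"
    unfolding * using e by (auto split: nat.split)
  have "ballot (Suc m) j =
      card (?A False False) + card (?A False True) + (card (?A True False) + card (?A True True))"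
    unfolding ballot_def card_open_NCP_Suc UNIV_bool by simp
  then show ?thesis
    unfolding FF TF FT TT ballot_def by (cases j) simp_all
qed

lemma open_NCP_0: "open_NCP 0 = {({}, {})}"
proof -
  have "NCP 0 = {{}}" by (auto simp: NCP_def partition_on_empty noncrossing_def)
  then show ?thesis by (auto simp: open_NCP_def)
qed

text \<open>The formula of the reflection principle for nonnegative paths, written without
  subtraction. The induction applies Pascal's rule twice, once for each of the two path steps that a
  vertex stands for.\<close>

lemma ballot_binomial: "ballot m j + (2 * m choose (m + j + 1)) = (2 * m choose (m + j))"
proof (induction m arbitrary: j)
  case 0
  have "{p \<in> open_NCP 0. card (snd p) = j} = (if j = 0 then {({}, {})} else {})"
    by (auto simp: open_NCP_0)
  then show ?case by (simp add: ballot_def)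
next
  case (Suc m)
  have c2: "2 * Suc m choose (Suc (Suc k)) =
    (2 * m choose k) + 2 * (2 * m choose Suc k) + (2 * m choose Suc (Suc k))" for k
    by simp
  show ?case
  proof (cases j)
    case (Suc i)
    show ?thesis
      using Suc.IH[of i] Suc.IH[of "Suc i"] Suc.IH[of "Suc (Suc i)"] c2[of "m + i"] c2[of "m + i + 1"]
      by (simp add: ballot_Suc Suc)
  next
    case 0
    \<comment> \<open>At height 0 the symmetry of the binomial row turns the lower neighbour of the
      centre into the upper one.\<close>
    have r: "2 * Suc m choose Suc m = 2 * (2 * m choose m) + 2 * (2 * m choose Suc m)"
    proof (cases m)
      case (Suc k)
      have "2 * m choose k = 2 * m choose Suc m"
        using binomial_symmetric[of k "2 * m"] Suc by simp
      then show ?thesis using c2[of k] Suc by simp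
    qed simp
    show ?thesis
      using Suc.IH[of 0] Suc.IH[of 1] c2[of m] r by (simp add: ballot_Suc 0)
  qed
qed

section \<open>Half partitions with boundary conditions\<close>

lemma card_open_NCP: "card (open_NCP m) = (2 * m choose m)"
proof -
  \<comment> \<open>\<open>K\<close> exceeds every number of marks, so the slices exhaust the set,
    and it exceeds \<open>m\<close>, so the last term \<open>2 * m choose (m + K)\<close> of the
    telescoping sum vanishes.\<close>
  define K where "K = Suc (Max (insert m ((\<lambda>p. card (snd p)) ` open_NCP m)))"
  have fin: "finite (insert m ((\<lambda>p. card (snd p)) ` open_NCP m))" using finite_open_NCP by simp
  have K: "m < K" "\<And>p. p \<in> open_NCP m \<Longrightarrow> card (snd p) < K"
    unfolding K_def less_Suc_eq_le using fin by (auto intro: Max_ge)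
  have "open_NCP m = (\<Union>j<K. {p \<in> open_NCP m. card (snd p) = j})" using K by auto
  then have "card (open_NCP m) = card (\<Union>j<K. {p \<in> open_NCP m. card (snd p) = j})" by simp
  also have "\<dots> = (\<Sum>j<K. ballot m j)"
    unfolding ballot_def by (rule card_UN_disjoint) (auto simp: finite_open_NCP)
  finally have c: "card (open_NCP m) = (\<Sum>j<K. ballot m j)" .
  have "(\<Sum>j<k. ballot m j) + (2 * m choose (m + k)) = (2 * m choose m)" for k
  proof (induction k)
    case (Suc k)
    then show ?case using ballot_binomial[of m k] by simp
  qed simp
  from this[of K] show ?thesis using c K(1) by (simp add: binomial_eq_0)
qed

text \<open>The condition forces \<open>b\<close> and leaves \<open>c\<close> free, giving all half
  partitions plus those with a nonempty set of marks. The latter number is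
  \<open>2 * m choose Suc m\<close>, and Pascal's rule adds the two.\<close>

lemma card_open_NCP_last:
  "card {p \<in> open_NCP (Suc m). Suc m \<in> \<Union>(snd p)} = (Suc (2 * m) choose m)"
proof -
  let ?A = "\<lambda>c b. {(P, M) \<in> open_NCP m. (c \<longrightarrow> M \<noteq> {}) \<and>
    Suc m \<in> \<Union>(snd (adjoin (Suc m) P M (attach M c) b))}"
  have *: "?A c b = {p \<in> open_NCP m. (c \<longrightarrow> snd p \<noteq> {}) \<and> b}" for c b
    using Union_adjoin(1)[of _ _ m c b] by fastforce
  have "open_NCP m = {p \<in> open_NCP m. snd p \<noteq> {}} \<union> {p \<in> open_NCP m. card (snd p) = 0}"
    using finite_open_blocks[of _ _ m] by fastforce
  moreover have "card (\<dots>) = card {p \<in> open_NCP m. snd p \<noteq> {}} + ballot m 0"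
    unfolding ballot_def using finite_open_blocks[of _ _ m]
    by (intro card_Un_disjoint) (auto simp: finite_open_NCP)
  ultimately have s: "card (open_NCP m) = card {p \<in> open_NCP m. snd p \<noteq> {}} + ballot m 0" by simp
  have "2 * m choose Suc m = (if m = 0 then 0 else 2 * m choose (m - 1))"
    using binomial_symmetric[of "m - 1" "2 * m"] by auto
  then have "Suc (2 * m) choose m = (2 * m choose m) + (2 * m choose Suc m)"
    by (cases m) simp_all
  then have "card (open_NCP m) + card {p \<in> open_NCP m. snd p \<noteq> {}} = (Suc (2 * m) choose m)"
    using s ballot_binomial[of m 0] card_open_NCP[of m] by simp
  then show ?thesis
    unfolding card_open_NCP_Suc UNIV_bool * by simp
qed

text \<open>A block enclosing a vertex \<open>a\<close> of \<open>A\<close> starts to the right of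
  1, hence crosses \<open>A\<close>, which contains both 1 and \<open>a\<close>.\<close>

lemma exposed_block_1:
  assumes "P \<in> NCP m" "A \<in> P" "1 \<in> A"
  shows "exposed A P"
  unfolding exposed_def
proof (intro ballI impI notI)
  fix C c d a assume h: "C \<in> P" "C \<noteq> A" "c \<in> C" "d \<in> C" "a \<in> A" "c < a \<and> a < d"
  have "c \<noteq> 1" using NCP_block_unique[OF assms(1), of C A c] h assms by blast
  then have "1 < c" using NCP_block_subset[OF assms(1) h(1)] h(3) by fastforce
  then show False
    using noncrossingD[OF NCP_noncrossing[OF assms(1)], of A C 1 a c d] assms h by blast
qed

text \<open>The block of the vertex 1 is always exposed, so it may be marked or unmarked freely.\<close>

lemma card_open_NCP_first:
  assumes "m \<ge> 1"
  shows "2 * card {p \<in> open_NCP m. 1 \<in> \<Union>(snd p)} = (2 * m choose m)"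
proof -
  let ?A = "{p \<in> open_NCP m. 1 \<in> \<Union>(snd p)}" and ?B = "{p \<in> open_NCP m. 1 \<notin> \<Union>(snd p)}"
  have "bij_betw (\<lambda>(P, M). (P, M - {A \<in> P. 1 \<in> A})) ?A ?B"
  proof (rule bij_betw_byWitness[where f' = "\<lambda>(P, M). (P, M \<union> {A \<in> P. 1 \<in> A})"])
    have "{A \<in> P. 1 \<in> A} \<subseteq> M" if "(P, M) \<in> ?A" for P M
    proof -
      have P: "P \<in> NCP m" "M \<subseteq> P" and "1 \<in> \<Union>M" using that by (auto simp: open_NCP_def)
      then obtain B where B: "B \<in> M" "1 \<in> B" by blast
      have "A = B" if "A \<in> P" "1 \<in> A" for A
        using NCP_block_unique[OF P(1) that(1) _ that(2) B(2)] B(1) P(2) by blast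
      then show ?thesis using B(1) by blast
    qed
    then show "\<forall>p\<in>?A. (\<lambda>(P, M). (P, M \<union> {A \<in> P. 1 \<in> A})) ((\<lambda>(P, M). (P, M - {A \<in> P. 1 \<in> A})) p) = p"
      by fastforce
    show "(\<lambda>(P, M). (P, M - {A \<in> P. 1 \<in> A})) ` ?A \<subseteq> ?B"
      by (auto simp: open_NCP_def)
    show "\<forall>p\<in>?B. (\<lambda>(P, M). (P, M - {A \<in> P. 1 \<in> A})) ((\<lambda>(P, M). (P, M \<union> {A \<in> P. 1 \<in> A})) p) = p"
      by (auto simp: open_NCP_def)
    show "(\<lambda>(P, M). (P, M \<union> {A \<in> P. 1 \<in> A})) ` ?B \<subseteq> ?A"
      using NCP_block_exists[of _ m 1] exposed_block_1[of _ m] assms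
      by (fastforce simp: open_NCP_def)
  qed
  then have "card ?A = card ?B" by (rule bij_betw_same_card)
  moreover have "card (?A \<union> ?B) = card ?A + card ?B"
    by (rule card_Un_disjoint) (auto simp: finite_open_NCP)
  moreover have "?A \<union> ?B = open_NCP m" by blast
  ultimately show ?thesis using card_open_NCP by simp
qed

text \<open>Marking the last vertex forces \<open>b\<close>; then vertex 1 is marked exactly if it
  was before. This already yields a marked block to join, so both values of \<open>c\<close>
  contribute the same number, half of the central binomial coefficient.\<close>

lemma card_open_NCP_first_last:
  assumes "m \<ge> 1"
  shows "card {p \<in> open_NCP (Suc m). 1 \<in> \<Union>(snd p) \<and> Suc m \<in> \<Union>(snd p)} = (2 * m choose m)"
proof -
  let ?A = "\<lambda>c b. {(P, M) \<in> open_NCP m. (c \<longrightarrow> M \<noteq> {}) \<and>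
    1 \<in> \<Union>(snd (adjoin (Suc m) P M (attach M c) b)) \<and> Suc m \<in> \<Union>(snd (adjoin (Suc m) P M (attach M c) b))}"
  have *: "?A c b = {p \<in> open_NCP m. b \<and> 1 \<in> \<Union>(snd p)}" for c b
  proof -
    have "(1 \<in> \<Union>(snd (adjoin (Suc m) P M (attach M c) b)) \<and>
        Suc m \<in> \<Union>(snd (adjoin (Suc m) P M (attach M c) b))) \<longleftrightarrow> b \<and> 1 \<in> \<Union>M"
      if "(P, M) \<in> open_NCP m" "c \<longrightarrow> M \<noteq> {}" for P M
      using Union_adjoin(1)[OF that, of b] Union_adjoin(2)[OF that, of 1 b] assms by auto
    moreover have "M \<noteq> {}" if "1 \<in> \<Union>M" for M :: "nat set set" using that by blast
    ultimately have "((P, M) \<in> open_NCP m \<and> (c \<longrightarrow> M \<noteq> {}) \<and>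
        1 \<in> \<Union>(snd (adjoin (Suc m) P M (attach M c) b)) \<and>
        Suc m \<in> \<Union>(snd (adjoin (Suc m) P M (attach M c) b))) \<longleftrightarrow>
      (P, M) \<in> open_NCP m \<and> b \<and> 1 \<in> \<Union>M" for P M
      by metis
    then show ?thesis by (subst set_eq_iff) (simp only: split_paired_All mem_Collect_eq case_prod_conv snd_conv simp_thms)
  qed
  show ?thesis
    unfolding card_open_NCP_Suc UNIV_bool * using card_open_NCP_first[OF assms] by simp
qed

section \<open>Partitions fixed by a reflection\<close>

text \<open>
  A reflection \<open>s\<close> of the circuit, cut open so that its lower half is \<open>{1..h}\<close>; the axis may pass
  through the vertices \<open>1\<close> and \<open>h\<close>.
\<close>

locale mirror =
  fixes L h :: nat and s :: "nat \<Rightarrow> nat"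
  assumes s_in: "x \<in> {1..L} \<Longrightarrow> s x \<in> {1..L}"
    and s_s: "x \<in> {1..L} \<Longrightarrow> s (s x) = x"
    and h_le: "h \<le> L"
    and half: "x \<in> {1..L} \<Longrightarrow> x \<le> h \<longleftrightarrow> x \<le> s x"
    and anti: "y \<in> {1..L} \<Longrightarrow> h < x \<Longrightarrow> x < y \<Longrightarrow> s y < s x"
    and fixed: "x \<in> {1..L} \<Longrightarrow> s x = x \<Longrightarrow> x = 1 \<or> x = h"
begin

definition to_half :: "nat \<Rightarrow> nat" where "to_half x = (if x \<le> h then x else s x)"

definition symmetric_NCP :: "nat set set set" where "symmetric_NCP = {P \<in> NCP L. (`) s ` P = P}"

text \<open>The block of a vertex on the axis meets its mirror image in that vertex, so it equals it
  and has to be marked.\<close>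

definition half_open :: "(nat set set \<times> nat set set) set" where
  "half_open = {p \<in> open_NCP h. \<forall>x\<in>{1..h}. s x = x \<longrightarrow> x \<in> \<Union>(snd p)}"

text \<open>
  The blocks obtained from a block \<open>A\<close> of the half: \<open>A \<union> s ` A\<close> for both values of \<open>b\<close> if \<open>A\<close> is
  marked, otherwise \<open>A\<close> (for \<open>b\<close>) or \<open>s ` A\<close> (for \<open>\<not> b\<close>).
\<close>

definition piece :: "nat set set \<Rightarrow> nat set \<Rightarrow> bool \<Rightarrow> nat set" where
  "piece M A b = {x \<in> {1..L}. to_half x \<in> A \<and> (A \<in> M \<or> (x \<le> h) = b)}"

definition unfold_half :: "nat set set \<times> nat set set \<Rightarrow> nat set set" where
  "unfold_half = (\<lambda>(Q, M). {piece M A b | A b. A \<in> Q})"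

definition fold_half :: "nat set set \<Rightarrow> nat set set \<times> nat set set" where
  "fold_half P = ((\<lambda>B. {1..h} \<inter> B) ` P - {{}}, {{1..h} \<inter> B | B. B \<in> P \<and> s ` B = B})"

lemma swap_half: "x \<in> {1..L} \<Longrightarrow> s x \<noteq> x \<Longrightarrow> s x \<le> h \<longleftrightarrow> \<not> x \<le> h"
  using half[of x] half[of "s x"] s_in[of x] s_s[of x] by auto

lemma above_half: "x \<in> {1..L} \<Longrightarrow> h < x \<Longrightarrow> s x \<le> h"
  using half[of x] swap_half[of x] by fastforce

lemma to_half_in: "x \<in> {1..L} \<Longrightarrow> to_half x \<in> {1..h}"
  using above_half[of x] s_in[of x] by (auto simp: to_half_def)

lemma to_half_s: "x \<in> {1..L} \<Longrightarrow> to_half (s x) = to_half x"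
  using swap_half[of x] s_s[of x] by (cases "s x = x") (auto simp: to_half_def)

text \<open>The assumption \<open>anti\<close> speaks only of vertices above \<open>h\<close>,
  because a fixed vertex 1 would violate it below. Applying it to the mirror images covers the lower
  vertices off the axis.\<close>

lemma anti_below:
  assumes "x \<in> {1..L}" "y \<in> {1..L}" "x < y" "y \<le> h" "s x \<noteq> x" "s y \<noteq> y"
  shows "s y < s x"
proof (rule ccontr)
  assume "\<not> s y < s x"
  moreover have "s x \<noteq> s y" using s_s[OF assms(1)] s_s[OF assms(2)] assms(3) by (metis less_irrefl)
  ultimately have "s x < s y" by simp
  moreover have "h < s x" using swap_half[OF assms(1,5)] assms by simp
  ultimately show False using anti[of "s y" "s x"] s_in s_s assms by fastforce
qed

section \<open>Folding a symmetric partition\<close>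

context
  fixes P assumes P: "P \<in> symmetric_NCP"
begin

lemma P_NCP: "P \<in> NCP L" and s_image: "B \<in> P \<Longrightarrow> s ` B \<in> P"
  using P by (auto simp: symmetric_NCP_def)

lemma P_in: "B \<in> P \<Longrightarrow> x \<in> B \<Longrightarrow> x \<in> {1..L}"
  using NCP_block_subset[OF P_NCP] by blast

lemma P_unique: "B \<in> P \<Longrightarrow> C \<in> P \<Longrightarrow> x \<in> B \<Longrightarrow> x \<in> C \<Longrightarrow> B = C"
  by (rule NCP_block_unique[OF P_NCP])

text \<open>A block with vertices on both sides of the axis would cross its own mirror image.\<close>

lemma crossing_block_symmetric:
  assumes "B \<in> P" "x \<in> B" "x \<le> h" "y \<in> B" "h < y"
  shows "s ` B = B"
proof (rule ccontr)
  assume ne: "s ` B \<noteq> B"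
  have x: "x \<in> {1..L}" and y: "y \<in> {1..L}" using P_in assms by blast+
  have disj: "z \<in> B \<Longrightarrow> s z \<notin> B" for z using P_unique[OF s_image[OF assms(1)] assms(1)] ne by blast
  have sx: "s x \<noteq> x" and sy: "s y \<noteq> y" and "s y \<noteq> x"
    using disj[of x] disj[of y] assms by auto
  then have syh: "s y \<le> h" and sxh: "h < s x" using above_half[OF y] assms swap_half[OF x sx] by auto
  have Bs: "s x \<in> s ` B" "s y \<in> s ` B" using assms by auto
  \<comment> \<open>The four vertices alternate between \<open>B\<close> and its mirror image in
    both cases: \<open>x < s y < y < s x\<close> or \<open>s y < x < s x < y\<close>.\<close>
  consider "x < s y" | "s y < x" using \<open>s y \<noteq> x\<close> by linarith
  then show False
  proof cases
    case 1
    have "s y \<noteq> s (s y)" using sy s_s[OF y] by simp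
    then have "y < s x" using anti_below[of x "s y"] 1 x sx syh s_in[OF y] s_s[OF y] by auto
    then show False
      using noncrossingD[OF NCP_noncrossing[OF P_NCP] assms(1) s_image[OF assms(1)] ne[symmetric] assms(2,4) Bs(2,1)]
        1 syh assms(5) by simp
  next
    case 2
    have "s x < y" using anti_below[of "s y" x] 2 x sx sy assms s_in[OF y] s_s[OF y] by auto
    then show False
      using noncrossingD[OF NCP_noncrossing[OF P_NCP] s_image[OF assms(1)] assms(1) ne Bs(2,1) assms(2,4)]
        2 sxh assms(3) by simp
  qed
qed

lemma to_half_mem_symmetric: "B \<in> P \<Longrightarrow> s ` B = B \<Longrightarrow> x \<in> {1..L} \<Longrightarrow> to_half x \<in> B \<longleftrightarrow> x \<in> B"
  using s_s[of x] unfolding to_half_def by (metis imageI)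

lemma symmetric_meets_half: "B \<in> P \<Longrightarrow> s ` B = B \<Longrightarrow> \<exists>x\<in>B. x \<in> {1..h}"
  using NCP_block_nonempty[OF P_NCP, of B] P_in to_half_in to_half_mem_symmetric by (metis ex_in_conv)

text \<open>The main point is that traces of stable blocks are exposed: if \<open>c < a < d\<close>
  held in the half with \<open>a\<close> in a stable block, the mirror image of \<open>a\<close>
  beyond \<open>d\<close> would complete a crossing.\<close>

lemma fold_in: "fold_half P \<in> half_open"
proof -
  let ?Q = "(\<lambda>B. {1..h} \<inter> B) ` P - {{}}"
  let ?M = "{{1..h} \<inter> B | B. B \<in> P \<and> s ` B = B}"
  have "partition_on {1..L} P" using P_NCP by (simp add: NCP_def)
  then have "partition_on ({1..h} \<inter> {1..L}) ?Q" using partition_on_restrict by blast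
  moreover have "{1..h} \<inter> {1..L} = {1..h}" using h_le by auto
  ultimately have "partition_on {1..h} ?Q" by (simp only:)
  moreover have "noncrossing ?Q"
    unfolding noncrossing_def
  proof
    assume "\<exists>a b c d. a < b \<and> b < c \<and> c < d \<and>
      (\<exists>B\<in>?Q. \<exists>C\<in>?Q. B \<noteq> C \<and> a \<in> B \<and> c \<in> B \<and> b \<in> C \<and> d \<in> C)"
    then obtain a b c d B C where h: "a < b" "b < c" "c < d" "B \<in> P" "C \<in> P" "{1..h} \<inter> B \<noteq> {1..h} \<inter> C"
      "a \<in> B" "c \<in> B" "b \<in> C" "d \<in> C"
      by blast
    then have "B \<noteq> C" by blast
    then show False
      using noncrossingD[OF NCP_noncrossing[OF P_NCP], of B C a c b d] h by simp
  qed
  moreover have "?M \<subseteq> ?Q" using symmetric_meets_half by blast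
  moreover have "exposed ({1..h} \<inter> B) ?Q" if B: "B \<in> P" "s ` B = B" for B
    unfolding exposed_def
  proof (intro ballI impI notI)
    fix C c d a
    assume h: "C \<in> ?Q" "C \<noteq> {1..h} \<inter> B" "c \<in> C" "d \<in> C" "a \<in> {1..h} \<inter> B" "c < a \<and> a < d"
    obtain C' where C': "C' \<in> P" "C = {1..h} \<inter> C'" using h by blast
    then have ne: "C' \<noteq> B" using h by blast
    have cd: "c \<in> {1..h}" "c \<in> C'" "d \<in> {1..h}" "d \<in> C'" using C' h by auto
    have a: "a \<in> {1..L}" "a \<in> B" using P_in B h by blast+
    \<comment> \<open>Only 1 and \<open>h\<close> can lie on the axis, and \<open>a\<close> is
      strictly between two vertices of the half, so its mirror image lies above
      \<open>h\<close>.\<close>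
    have "a \<noteq> 1" "a \<noteq> h" using cd h by auto
    then have "h < s a" using fixed[OF a(1)] swap_half[OF a(1)] h by fastforce
    moreover have "s a \<in> B" using a(2) B(2) by blast
    ultimately show False
      using noncrossingD[OF NCP_noncrossing[OF P_NCP], of C' B c d a "s a"] C' B ne cd a h by simp
  qed
  moreover have "x \<in> \<Union>?M" if x: "x \<in> {1..h}" "s x = x" for x
  proof -
    have "x \<in> {1..L}" using x h_le by auto
    then obtain B where B: "B \<in> P" "x \<in> B" using NCP_block_exists[OF P_NCP] by blast
    then have "x \<in> s ` B" using x(2) by (metis imageI)
    then have "s ` B = B" using P_unique[OF s_image] B by blast
    then show ?thesis using B x by blast
  qed
  ultimately show ?thesis
    unfolding half_open_def fold_half_def open_NCP_def NCP_def by auto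
qed

text \<open>A block that is not stable under \<open>s\<close> stays on one side of the axis. It or
  its mirror image is therefore visible in the half, and the two pieces give back both.\<close>

lemma unfold_fold: "unfold_half (fold_half P) = P"
proof -
  let ?Q = "(\<lambda>B. {1..h} \<inter> B) ` P - {{}}"
  let ?M = "{{1..h} \<inter> B | B. B \<in> P \<and> s ` B = B}"
  have Mi: "{1..h} \<inter> B \<in> ?M \<longleftrightarrow> s ` B = B" if B: "B \<in> P" "{1..h} \<inter> B \<noteq> {}" for B
    using B P_unique by blast
  have sym_piece: "piece ?M ({1..h} \<inter> B) b = B" if B: "B \<in> P" "s ` B = B" for B b
    unfolding piece_def using B to_half_in to_half_mem_symmetric P_in by blast
  have asym: "piece ?M ({1..h} \<inter> B) b = (if b then B else s ` B)"
    if B: "B \<in> P" "{1..h} \<inter> B \<noteq> {}" "s ` B \<noteq> B" for B b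
  proof -
    have low: "x \<le> h" if "x \<in> B" for x
      using crossing_block_symmetric[OF B(1)] B(2,3) that by fastforce
    have nf: "s x \<noteq> x" if "x \<in> B" for x
      using P_unique[OF s_image[OF B(1)] B(1), of x] B(3) that by (metis imageI)
    have high: "h < s x" if "x \<in> B" for x
      using swap_half[OF P_in[OF B(1) that] nf[OF that]] low[OF that] by simp
    have "{1..h} \<inter> B = B" using low P_in[OF B(1)] by fastforce
    moreover from this have "B \<notin> ?M" using Mi[OF B(1,2)] B(3) by simp
    then have "piece ?M B b = {x \<in> {1..L}. to_half x \<in> B \<and> (x \<le> h) = b}"
      unfolding piece_def by blast
    moreover have "{x \<in> {1..L}. to_half x \<in> B \<and> (x \<le> h) = b} = (if b then B else s ` B)"
    proof (cases b)
      case True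
      then show ?thesis using low P_in[OF B(1)] by (auto simp: to_half_def)
    next
      case False
      have "x \<in> s ` B" if "x \<in> {1..L}" "to_half x \<in> B" "\<not> x \<le> h" for x
        using s_s[OF that(1)] that by (metis to_half_def imageI)
      moreover have "s x \<in> {1..L} \<and> to_half (s x) \<in> B \<and> \<not> s x \<le> h" if "x \<in> B" for x
        using s_in to_half_s low high P_in[OF B(1)] that by (fastforce simp: to_half_def)
      ultimately show ?thesis using False by auto
    qed
    ultimately show ?thesis by (simp only:)
  qed
  have "unfold_half (fold_half P) \<subseteq> P"
  proof
    fix Y assume "Y \<in> unfold_half (fold_half P)"
    then obtain B b where B: "B \<in> P" "{1..h} \<inter> B \<noteq> {}" "Y = piece ?M ({1..h} \<inter> B) b"
      unfolding unfold_half_def fold_half_def by auto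
    then show "Y \<in> P" using sym_piece[of B b] asym[of B b] s_image[of B] by (cases "s ` B = B") auto
  qed
  moreover have "P \<subseteq> unfold_half (fold_half P)"
  proof
    fix B assume B: "B \<in> P"
    have mem: "piece ?M ({1..h} \<inter> C) b \<in> unfold_half (fold_half P)" if "C \<in> P" "{1..h} \<inter> C \<noteq> {}" for C b
      using that unfolding unfold_half_def fold_half_def by auto
    show "B \<in> unfold_half (fold_half P)"
    proof (cases "{1..h} \<inter> B = {}")
      case False
      show ?thesis
      proof (cases "s ` B = B")
        case True
        then show ?thesis using mem[OF B False, of True] sym_piece[OF B] by simp
      qed (use mem[OF B False, of True] asym[OF B False, of True] in simp)
    next
      case True
      then have ns: "s ` B \<noteq> B" using symmetric_meets_half[OF B] by blast
      have ss: "s ` s ` B = B" using s_s P_in[OF B] by (force simp: image_iff)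
      obtain x where x: "x \<in> B" using NCP_block_nonempty[OF P_NCP B] by blast
      then have "h < x" using True P_in[OF B x] by fastforce
      then have "s x \<in> {1..h}" using above_half s_in P_in[OF B x] by fastforce
      then have ne: "{1..h} \<inter> s ` B \<noteq> {}" using x by blast
      then show ?thesis
        using mem[OF s_image[OF B] ne, of False] asym[OF s_image[OF B] ne, of False] ns ss by simp
    qed
  qed
  ultimately show ?thesis by blast
qed

end

section \<open>Unfolding a half partition\<close>

context
  fixes Q M assumes QM: "(Q, M) \<in> half_open"
begin

lemma Q_NCP: "Q \<in> NCP h" and M_sub: "M \<subseteq> Q" and M_exposed: "A \<in> M \<Longrightarrow> exposed A Q"
  and M_fixed: "x \<in> {1..h} \<Longrightarrow> s x = x \<Longrightarrow> x \<in> \<Union>M"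
  using QM by (auto simp: half_open_def open_NCP_def)

lemma Q_unique: "A \<in> Q \<Longrightarrow> B \<in> Q \<Longrightarrow> x \<in> A \<Longrightarrow> x \<in> B \<Longrightarrow> A = B"
  by (rule NCP_block_unique[OF Q_NCP])

lemma Q_in: "A \<in> Q \<Longrightarrow> x \<in> A \<Longrightarrow> x \<in> {1..h} \<and> x \<in> {1..L}"
  using NCP_block_subset[OF Q_NCP] h_le by fastforce

text \<open>This is where the boundary condition of \<open>half_open\<close> enters: off the axis,
  \<open>s\<close> really exchanges the two sides, so the two pieces of an unmarked block are mirror
  images.\<close>

lemma closed_not_fixed: "A \<in> Q \<Longrightarrow> A \<notin> M \<Longrightarrow> x \<in> {1..L} \<Longrightarrow> to_half x \<in> A \<Longrightarrow> s x \<noteq> x"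
proof
  assume h: "A \<in> Q" "A \<notin> M" "x \<in> {1..L}" "to_half x \<in> A" "s x = x"
  then have "x \<in> {1..h}" "x \<in> A" using half[of x] by (auto simp: to_half_def)
  then show False using M_fixed[of x] M_sub Q_unique[OF h(1)] h by blast
qed

lemma piece_nonempty:
  assumes "A \<in> Q"
  shows "piece M A b \<noteq> {}"
proof -
  obtain a where a: "a \<in> A" using NCP_block_nonempty[OF Q_NCP assms] by blast
  then have h: "a \<le> h" "a \<in> {1..L}" using Q_in[OF assms] by auto
  then have fa: "to_half a = a" by (simp add: to_half_def)
  show ?thesis
  proof (cases "A \<in> M \<or> b")
    case True
    then have "a \<in> piece M A b" using a h fa by (auto simp: piece_def)
    then show ?thesis by blast
  next
    case False
    then have "s a \<noteq> a" using closed_not_fixed[OF assms, of a] a h fa by simp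
    then have "s a \<in> piece M A b"
      using False to_half_s[of a] fa a h s_in[of a] swap_half[of a] by (auto simp: piece_def)
    then show ?thesis by blast
  qed
qed

lemma piece_eqI:
  assumes "A \<in> Q" "B \<in> Q" "x \<in> piece M A b" "x \<in> piece M B c"
  shows "A = B" "piece M A b = piece M B c"
proof -
  have "to_half x \<in> A" "to_half x \<in> B" using assms by (auto simp: piece_def)
  then show "A = B" using Q_unique assms by blast
  then show "piece M A b = piece M B c" using assms by (auto simp: piece_def)
qed

lemma s_piece:
  assumes "A \<in> Q"
  shows "s ` piece M A b = piece M A (\<not> b)"
proof -
  have *: "s x \<in> piece M A (\<not> c)" if "x \<in> piece M A c" for x c
  proof -
    have x: "x \<in> {1..L}" "to_half x \<in> A" "A \<in> M \<or> (x \<le> h) = c" using that by (auto simp: piece_def)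
    have "A \<in> M \<or> (s x \<le> h) = (\<not> c)"
      using closed_not_fixed[OF assms _ x(1,2)] swap_half[OF x(1)] x(3) by blast
    then show ?thesis using x s_in to_half_s by (simp add: piece_def)
  qed
  show ?thesis
  proof
    show "s ` piece M A b \<subseteq> piece M A (\<not> b)" using * by blast
    show "piece M A (\<not> b) \<subseteq> s ` piece M A b"
    proof
      fix x assume x: "x \<in> piece M A (\<not> b)"
      then have "x \<in> {1..L}" by (simp add: piece_def)
      then have "x = s (s x)" using s_s by simp
      moreover have "s x \<in> piece M A b" using *[OF x] by simp
      ultimately show "x \<in> s ` piece M A b" by (rule image_eqI)
    qed
  qed
qed

text \<open>A crossing is folded into the half by \<open>to_half\<close>, which reverses the order
  above \<open>h\<close>. If all four vertices lie on one side, it becomes a crossing in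
  \<open>Q\<close>; otherwise some block reaches across the axis, is thus marked, and gets enclosed
  by the other one.\<close>

lemma unfold_noncrossing:
  assumes "A \<in> Q" "B \<in> Q" "piece M A b \<noteq> piece M B c"
    "w \<in> piece M A b" "y \<in> piece M A b" "x \<in> piece M B c" "z \<in> piece M B c"
    "w < x" "x < y" "y < z"
  shows False
proof -
  have w: "to_half w \<in> A" "A \<in> M \<or> (w \<le> h) = b" and y: "y \<in> {1..L}" "to_half y \<in> A" "A \<in> M \<or> (y \<le> h) = b"
    and x: "x \<in> {1..L}" "to_half x \<in> B" "B \<in> M \<or> (x \<le> h) = c"
    and z: "z \<in> {1..L}" "to_half z \<in> B" "B \<in> M \<or> (z \<le> h) = c"
    using assms(4-7) by (simp_all add: piece_def)
  show False
  proof (cases "A = B")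
    case True
    then have "A \<notin> M" "b \<noteq> c" using assms(3) by (auto simp: piece_def)
    then show False using w(2) y(3) x(3) z(3) True assms(8-10) by auto
  next
    case AB: False
    note cross = noncrossingD[OF NCP_noncrossing[OF Q_NCP]]
    show False
    proof (cases "y \<le> h")
      case True
      then have e: "to_half w = w" "to_half x = x" "to_half y = y" using assms(8-10) by (auto simp: to_half_def)
      show False
      proof (cases "z \<le> h")
        case z': True
        then have "to_half z = z" by (simp add: to_half_def)
        then show False using cross[OF assms(1,2) AB, of w y x z] w y x z e assms(8-10) by simp
      next
        case False
        then have "B \<in> M" using x(3) z(3) True assms(9) by auto
        then show False
          using exposedD[OF M_exposed assms(1) AB, of w y x] w y x e assms(8,9) by simp
      qed
    next
      case yh: False
      then have zy: "to_half z < to_half y" using anti[OF z(1), of y] assms(10) by (simp add: to_half_def)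
      show False
      proof (cases "x \<le> h")
        case False
        then have yx: "to_half y < to_half x" using anti[OF y(1), of x] assms(9) yh by (simp add: to_half_def)
        show False
        proof (cases "w \<le> h")
          case True
          then have "A \<in> M" using w(2) y(3) yh by blast
          then show False
            using exposedD[OF M_exposed assms(2) AB[symmetric], of "to_half z" "to_half x" "to_half y"] zy yx x z y by simp
        next
          case False
          then have "to_half x < to_half w" using anti[OF x(1), of w] assms(8) \<open>\<not> x \<le> h\<close> by (simp add: to_half_def)
          then show False
            using cross[OF assms(2,1) AB[symmetric], of "to_half z" "to_half x" "to_half y" "to_half w"] zy yx x z y w by simp
        qed
      next
        case True
        then have e: "to_half x = x" "to_half w = w" and AM: "A \<in> M" and BM: "B \<in> M"
          using assms(8-10) w(2) y(3) x(3) z(3) yh by (auto simp: to_half_def)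
        \<comment> \<open>Here both blocks are marked, and the order of \<open>x\<close> and the
          image of \<open>y\<close> decides whether \<open>A\<close> encloses \<open>x\<close> or
          \<open>B\<close> encloses \<open>to_half y\<close>.\<close>
        have "to_half y \<noteq> to_half x" using Q_unique[OF assms(1,2)] AB y(2) x(2) by metis
        then consider "x < to_half y" | "to_half y < x" using e by linarith
        then show False
        proof cases
          case 1
          then show False
            using exposedD[OF M_exposed[OF BM] assms(1) AB, of w "to_half y" x] w y x e assms(8) by simp
        next
          case 2
          then show False
            using exposedD[OF M_exposed[OF AM] assms(2) AB[symmetric], of "to_half z" x "to_half y"] zy z y x e by simp
        qed
      qed
    qed
  qed
qed

lemma unfold_in: "unfold_half (Q, M) \<in> symmetric_NCP"
proof -
  have U: "unfold_half (Q, M) = {piece M A b | A b. A \<in> Q}" by (simp add: unfold_half_def)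
  have "unfold_half (Q, M) \<in> NCP L"
  proof (rule NCPI)
    fix B x assume "B \<in> unfold_half (Q, M)" "x \<in> B"
    then show "x \<in> {1..L}" by (auto simp: U piece_def)
  next
    fix x assume x: "x \<in> {1..L}"
    then obtain A where "A \<in> Q" "to_half x \<in> A" using NCP_block_exists[OF Q_NCP to_half_in] by blast
    then have "x \<in> piece M A (x \<le> h)" "piece M A (x \<le> h) \<in> unfold_half (Q, M)"
      using x by (auto simp: piece_def U)
    then show "\<exists>B\<in>unfold_half (Q, M). x \<in> B" by blast
  next
    fix B C x assume "B \<in> unfold_half (Q, M)" "C \<in> unfold_half (Q, M)" "x \<in> B" "x \<in> C"
    then show "B = C" unfolding U using piece_eqI(2) by blast
  next
    show "{} \<notin> unfold_half (Q, M)" using piece_nonempty unfolding U by blast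
  next
    fix B C a b c d
    assume h: "B \<in> unfold_half (Q, M)" "C \<in> unfold_half (Q, M)" "B \<noteq> C" "a \<in> B" "b \<in> C" "c \<in> B" "d \<in> C"
      "a < b" "b < c" "c < d"
    obtain A p A' p' where "A \<in> Q" "B = piece M A p" "A' \<in> Q" "C = piece M A' p'"
      using h(1,2) unfolding U by blast
    then show False using unfold_noncrossing[of A A' p p' a c b d] h by blast
  qed
  moreover have "(`) s ` unfold_half (Q, M) = unfold_half (Q, M)"
  proof
    show "(`) s ` unfold_half (Q, M) \<subseteq> unfold_half (Q, M)" unfolding U using s_piece by blast
    show "unfold_half (Q, M) \<subseteq> (`) s ` unfold_half (Q, M)"
    proof
      fix Y assume "Y \<in> unfold_half (Q, M)"
      then obtain A b where A: "A \<in> Q" "Y = piece M A b" unfolding U by blast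
      then have "Y = s ` piece M A (\<not> b)" using s_piece[OF A(1), of "\<not> b"] by simp
      moreover have "piece M A (\<not> b) \<in> unfold_half (Q, M)" unfolding U using A by blast
      ultimately show "Y \<in> (`) s ` unfold_half (Q, M)" by (rule image_eqI)
    qed
  qed
  ultimately show ?thesis by (simp add: symmetric_NCP_def)
qed

text \<open>The pieces of an unmarked block are nonempty, disjoint and exchanged by
  \<open>s\<close>, so stable pieces come exactly from marked blocks.\<close>

lemma fold_unfold: "fold_half (unfold_half (Q, M)) = (Q, M)"
proof -
  have U: "unfold_half (Q, M) = {piece M A b | A b. A \<in> Q}" by (simp add: unfold_half_def)
  have half: "{1..h} \<inter> piece M A b = (if A \<in> M \<or> b then A else {})" if "A \<in> Q" for A b
    using Q_in[OF that] h_le by (auto simp: piece_def to_half_def)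
  have symm: "s ` piece M A b = piece M A b \<longleftrightarrow> A \<in> M" if A: "A \<in> Q" for A b
  proof
    assume "s ` piece M A b = piece M A b"
    then have e: "piece M A (\<not> b) = piece M A b" using s_piece[OF A] by simp
    obtain x where "x \<in> piece M A b" using piece_nonempty[OF A] by blast
    moreover from this have "x \<in> piece M A (\<not> b)" using e by simp
    ultimately show "A \<in> M" by (auto simp: piece_def)
  next
    assume "A \<in> M"
    then show "s ` piece M A b = piece M A b" unfolding s_piece[OF A] by (simp add: piece_def)
  qed
  have "(\<lambda>B. {1..h} \<inter> B) ` unfold_half (Q, M) - {{}} = Q"
  proof
    show "(\<lambda>B. {1..h} \<inter> B) ` unfold_half (Q, M) - {{}} \<subseteq> Q"
    proof
      fix Y assume "Y \<in> (\<lambda>B. {1..h} \<inter> B) ` unfold_half (Q, M) - {{}}"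
      then obtain A b where "A \<in> Q" "Y = {1..h} \<inter> piece M A b" "Y \<noteq> {}" unfolding U by blast
      then show "Y \<in> Q" using half[of A b] by (auto split: if_splits)
    qed
    show "Q \<subseteq> (\<lambda>B. {1..h} \<inter> B) ` unfold_half (Q, M) - {{}}"
    proof
      fix A assume A: "A \<in> Q"
      then have "A = {1..h} \<inter> piece M A True" "piece M A True \<in> unfold_half (Q, M)" "A \<noteq> {}"
        using half NCP_block_nonempty[OF Q_NCP] unfolding U by auto
      then show "A \<in> (\<lambda>B. {1..h} \<inter> B) ` unfold_half (Q, M) - {{}}" by blast
    qed
  qed
  moreover have "{{1..h} \<inter> B | B. B \<in> unfold_half (Q, M) \<and> s ` B = B} = M"
  proof
    show "{{1..h} \<inter> B | B. B \<in> unfold_half (Q, M) \<and> s ` B = B} \<subseteq> M"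
    proof
      fix Y assume "Y \<in> {{1..h} \<inter> B | B. B \<in> unfold_half (Q, M) \<and> s ` B = B}"
      then obtain A b where A: "A \<in> Q" "Y = {1..h} \<inter> piece M A b" "s ` piece M A b = piece M A b"
        unfolding U by blast
      then show "Y \<in> M" using symm[OF A(1), of b] half[OF A(1), of b] by simp
    qed
    show "M \<subseteq> {{1..h} \<inter> B | B. B \<in> unfold_half (Q, M) \<and> s ` B = B}"
    proof
      fix A assume A: "A \<in> M"
      then have AQ: "A \<in> Q" using M_sub by blast
      then have "A = {1..h} \<inter> piece M A True" "piece M A True \<in> unfold_half (Q, M)"
        "s ` piece M A True = piece M A True"
        using half[OF AQ] symm[OF AQ] A unfolding U by auto
      then show "A \<in> {{1..h} \<inter> B | B. B \<in> unfold_half (Q, M) \<and> s ` B = B}" by blast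
    qed
  qed
  ultimately show ?thesis by (simp add: fold_half_def)
qed

end

lemma card_symmetric_NCP: "card symmetric_NCP = card half_open"
proof -
  have "bij_betw fold_half symmetric_NCP half_open"
  proof (rule bij_betw_byWitness[where f' = unfold_half])
    show "\<forall>P\<in>symmetric_NCP. unfold_half (fold_half P) = P" using unfold_fold by blast
    show "\<forall>p\<in>half_open. fold_half (unfold_half p) = p" using fold_unfold by auto
    show "fold_half ` symmetric_NCP \<subseteq> half_open" using fold_in by blast
    show "unfold_half ` half_open \<subseteq> symmetric_NCP" using unfold_in by auto
  qed
  then show ?thesis by (rule bij_betw_same_card)
qed

end

section \<open>The two types of axis\<close>

lemma card_fixed_reflection:
  "card {P \<in> NCP L. (`) (reflection L) ` P = P} = (L choose (L div 2))"
proof -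
  \<comment> \<open>Rounding up keeps the middle vertex, which is on the axis for odd
    \<open>L\<close>, as the last vertex of the half.\<close>
  interpret mirror L "(L + 1) div 2" "reflection L"
    by unfold_locales (auto simp: reflection_def)
  obtain m where "L = 2 * m \<or> L = Suc (2 * m)" by (metis even_Suc evenE oddE Suc_eq_plus1)
  then have "card half_open = (L choose (L div 2))"
  proof
    assume L: "L = 2 * m"
    then have "reflection L x \<noteq> x" if "x \<in> {1..m}" for x
      using that by (auto simp: reflection_def)
    moreover have "(L + 1) div 2 = m" using L by simp
    ultimately have "half_open = open_NCP m"
      unfolding half_open_def by auto
    then show ?thesis using card_open_NCP L by simp
  next
    assume L: "L = Suc (2 * m)"
    have fx: "x \<in> {1..Suc m} \<and> reflection L x = x \<longleftrightarrow> x = Suc m" for x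
      using L by (auto simp: reflection_def)
    have "(\<forall>x\<in>{1..Suc m}. reflection L x = x \<longrightarrow> x \<in> U) \<longleftrightarrow> Suc m \<in> U" for U
      unfolding Ball_def imp_conjL[symmetric] fx by auto
    moreover have "(L + 1) div 2 = Suc m" using L by simp
    ultimately have "half_open = {p \<in> open_NCP (Suc m). Suc m \<in> \<Union>(snd p)}"
      unfolding half_open_def by (simp only:)
    then show ?thesis using card_open_NCP_last[of m] L by simp
  qed
  then show ?thesis using card_symmetric_NCP by (simp add: symmetric_NCP_def)
qed

text \<open>The composition fixes 1 and sends every other vertex \<open>x\<close> to
  \<open>L + 2 - x\<close>. For even \<open>L\<close> it also fixes the last vertex of the half; for
  odd \<open>L\<close> vertex 1 is the only one on the axis.\<close>

lemma card_fixed_rotation_reflection: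
  assumes "L \<ge> 1"
  shows "card {P \<in> NCP L. (`) (rotation L \<circ> reflection L) ` P = P} = (L choose (L div 2))"
proof -
  define s where "s x = (if x \<in> {2..L} then L + 2 - x else x)" for x
  have s: "rotation L \<circ> reflection L = s"
  proof
    fix x
    consider "x = 1" | "x \<in> {2..L}" | "x \<notin> {1..L}" by fastforce
    then show "(rotation L \<circ> reflection L) x = s x"
      using assms by cases (auto simp: rotation_def reflection_def s_def)
  qed
  interpret mirror L "(L + 2) div 2" s
    using assms by unfold_locales (auto simp: s_def split: if_splits)
  obtain m where "L = 2 * m \<or> L = Suc (2 * m)" by (metis even_Suc evenE oddE Suc_eq_plus1)
  then have "card half_open = (L choose (L div 2))"
  proof
    assume L: "L = 2 * m"
    have fx: "x \<in> {1..Suc m} \<and> s x = x \<longleftrightarrow> x = 1 \<or> x = Suc m" for x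
      using L assms by (auto simp: s_def)
    have "(\<forall>x\<in>{1..Suc m}. s x = x \<longrightarrow> x \<in> U) \<longleftrightarrow> 1 \<in> U \<and> Suc m \<in> U" for U
      unfolding Ball_def imp_conjL[symmetric] fx by auto
    moreover have "(L + 2) div 2 = Suc m" using L by simp
    ultimately have "half_open = {p \<in> open_NCP (Suc m). 1 \<in> \<Union>(snd p) \<and> Suc m \<in> \<Union>(snd p)}"
      unfolding half_open_def by (simp only:)
    then show ?thesis using card_open_NCP_first_last[of m] L assms by simp
  next
    assume L: "L = Suc (2 * m)"
    have fx: "x \<in> {1..Suc m} \<and> s x = x \<longleftrightarrow> x = 1" for x
      using L by (auto simp: s_def)
    have "(\<forall>x\<in>{1..Suc m}. s x = x \<longrightarrow> x \<in> U) \<longleftrightarrow> 1 \<in> U" for U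
      unfolding Ball_def imp_conjL[symmetric] fx by auto
    moreover have "(L + 2) div 2 = Suc m" using L by simp
    ultimately have "half_open = {p \<in> open_NCP (Suc m). 1 \<in> \<Union>(snd p)}"
      unfolding half_open_def by (simp only:)
    then have "2 * card half_open = (2 * Suc m choose Suc m)"
      using card_open_NCP_first[of "Suc m"] by simp
    also have "\<dots> = 2 * (Suc (2 * m) choose m)"
      using binomial_symmetric[of m "Suc (2 * m)"] by simp
    finally show ?thesis using L by simp
  qed
  then show ?thesis using card_symmetric_NCP s by (simp add: symmetric_NCP_def)
qed

section \<open>Orbits of a dihedral action\<close>

text \<open>Kept abstract because it is used on two levels: on vertices to list the elements of the
  groups, and on partitions to count orbits.\<close>

locale dihedral_action =
  fixes n :: nat and r s :: "'a \<Rightarrow> 'a" and E :: "'a set"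
  assumes n_pos: "n > 0" and fin: "finite E"
    and r_in: "x \<in> E \<Longrightarrow> r x \<in> E" and s_in: "x \<in> E \<Longrightarrow> s x \<in> E"
    and r_order: "(r ^^ n) x = x" and s_s: "s (s x) = x" and r_s_r: "r (s (r x)) = s x"
begin

definition orb :: "'a \<Rightarrow> 'a set" where "orb x = range (\<lambda>k. (r ^^ k) x)"

lemma pow_mult_order: "(r ^^ (n * k)) x = x"
  by (induction k) (simp_all add: funpow_add r_order)

lemma pow_mod: "(r ^^ (k mod n)) x = (r ^^ k) x"
proof -
  have "(r ^^ k) x = (r ^^ (k mod n + n * (k div n))) x" by simp
  then show ?thesis unfolding funpow_add comp_def pow_mult_order by simp
qed

text \<open>Multiples of \<open>n - 1\<close> replace negative exponents.\<close>

lemma pow_inverse: "(r ^^ (k * (n - 1))) ((r ^^ k) x) = x"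
proof -
  have "k * (n - 1) + k = n * k" using n_pos by (cases n) simp_all
  then show ?thesis using pow_mult_order[of k x] by (metis comp_apply funpow_add)
qed

lemma pow_in: "x \<in> E \<Longrightarrow> (r ^^ k) x \<in> E"
  by (induction k) (simp_all add: r_in)

lemma pow_s_pow: "(r ^^ k) (s ((r ^^ k) x)) = s x"
  by (induction k arbitrary: x) (simp_all add: r_s_r funpow_swap1[symmetric], metis funpow_swap1 r_s_r)

lemma s_pow: "s ((r ^^ k) x) = (r ^^ (k * (n - 1))) (s x)"
  using pow_inverse[of k "s ((r ^^ k) x)"] by (simp add: pow_s_pow)

lemma bij_pow: "bij_betw (r ^^ k) E E"
proof -
  have "inj_on (r ^^ k) E" by (rule inj_on_inverseI) (rule pow_inverse)
  moreover have "(r ^^ k) ` E \<subseteq> E" using pow_in by blast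
  ultimately show ?thesis by (simp add: bij_betw_def endo_inj_surj fin)
qed

lemma self_in_orb: "x \<in> orb x"
  unfolding orb_def by (rule range_eqI[of _ _ 0]) simp

lemma orb_subset: "y \<in> orb x \<Longrightarrow> orb y \<subseteq> orb x"
  unfolding orb_def by (auto simp flip: funpow_add comp_apply[of "_ ^^ _" "_ ^^ _"])

lemma orb_eq:
  assumes "y \<in> orb x"
  shows "orb y = orb x"
proof
  obtain k where "y = (r ^^ k) x" using assms by (auto simp: orb_def)
  then have "x = (r ^^ (k * (n - 1))) y" by (simp only: pow_inverse)
  then have "x \<in> orb y" by (auto simp: orb_def)
  then show "orb x \<subseteq> orb y" by (rule orb_subset)
qed (rule orb_subset[OF assms])

lemma s_orb_subset: "s ` orb x \<subseteq> orb (s x)"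
  unfolding orb_def by (auto simp: s_pow)

lemma s_orb: "s ` orb x = orb (s x)"
proof
  have "orb (s x) = s ` s ` orb (s x)" by (simp add: image_image s_s)
  also have "\<dots> \<subseteq> s ` orb x" using s_orb_subset[of "s x"] by (auto simp: s_s)
  finally show "orb (s x) \<subseteq> s ` orb x" .
qed (rule s_orb_subset)

lemma orb_sub_X: "x \<in> E \<Longrightarrow> orb x \<subseteq> E"
  using pow_in by (auto simp: orb_def)

text \<open>\<open>hits x x\<close> plays the role of the order of the stabilizer of
  \<open>x\<close> among the exponents modulo \<open>n\<close>. The injection
  \<open>k \<mapsto> k + 1\<close> modulo \<open>n\<close> shows that hits do not decrease along
  \<open>r\<close>; going round the cycle makes them constant on the orbit, which yields the
  orbit-stabilizer formula.\<close>

definition hits :: "'a \<Rightarrow> 'a \<Rightarrow> nat" where "hits x y = card {k. k < n \<and> (r ^^ k) x = y}"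

lemma hits_le_r: "hits x y \<le> hits x (r y)"
  unfolding hits_def
proof (rule card_inj_on_le)
  let ?g = "\<lambda>k. Suc k mod n"
  show "inj_on ?g {k. k < n \<and> (r ^^ k) x = y}"
    by (rule inj_onI) (auto simp: mod_Suc split: if_splits)
  show "?g ` {k. k < n \<and> (r ^^ k) x = y} \<subseteq> {k. k < n \<and> (r ^^ k) x = r y}"
    using n_pos by (auto simp: pow_mod)
qed simp

lemma hits_le_pow: "hits x y \<le> hits x ((r ^^ k) y)"
  by (induction k) (use hits_le_r order_trans in fastforce)+

lemma hits_eq:
  assumes "y \<in> orb x"
  shows "hits x y = hits x x"
proof (rule antisym)
  obtain k where k: "y = (r ^^ k) x" using assms by (auto simp: orb_def)
  then have "x = (r ^^ (k * (n - 1))) y" by (simp only: pow_inverse)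
  then show "hits x y \<le> hits x x" using hits_le_pow by metis
  show "hits x x \<le> hits x y" using hits_le_pow k by metis
qed

lemma card_orb_mult_hits:
  assumes "x \<in> E" "y \<in> orb x"
  shows "card (orb x) * hits x y = n"
proof -
  have finO: "finite (orb x)" using orb_sub_X[OF assms(1)] fin by (rule finite_subset)
  have "n = (\<Sum>k<n. 1)" by simp
  also have "\<dots> = (\<Sum>z\<in>orb x. \<Sum>k\<in>{k \<in> {..<n}. (r ^^ k) x = z}. 1)"
    by (rule sum.group[symmetric]) (use finO in \<open>auto simp: orb_def\<close>)
  also have "\<dots> = (\<Sum>z\<in>orb x. hits x z)"
    by (simp add: hits_def)
  also have "\<dots> = (\<Sum>z\<in>orb x. hits x y)"
    by (rule sum.cong) (simp_all add: hits_eq assms(2))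
  finally show ?thesis by simp
qed

text \<open>
  A reflection \<open>s \<circ> r ^^ k\<close> fixes \<open>x\<close> iff \<open>r ^^ k\<close> maps \<open>x\<close> to \<open>s x\<close>; within an orbit that is stable
  under \<open>s\<close> there are \<open>n\<close> such pairs \<open>(x, k)\<close>.
\<close>

lemma sum_card_fixed:
  "(\<Sum>k<n. card {x \<in> E. s ((r ^^ k) x) = x}) = n * card {t \<in> orb ` E. s ` t = t}"
proof -
  have "(\<Sum>k<n. card {x \<in> E. s ((r ^^ k) x) = x}) = (\<Sum>k<n. \<Sum>x\<in>E. of_bool ((r ^^ k) x = s x))"
  proof (rule sum.cong[OF refl])
    fix k
    have "{x \<in> E. s ((r ^^ k) x) = x} = {x \<in> E. (r ^^ k) x = s x}" using s_s by metis
    then show "card {x \<in> E. s ((r ^^ k) x) = x} = (\<Sum>x\<in>E. of_bool ((r ^^ k) x = s x))"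
      using fin by (simp add: Int_def)
  qed
  also have "\<dots> = (\<Sum>x\<in>E. \<Sum>k<n. of_bool ((r ^^ k) x = s x))" by (rule sum.swap)
  also have "\<dots> = (\<Sum>x\<in>E. hits x (s x))"
    by (simp add: hits_def Int_def)
  also have "\<dots> = (\<Sum>t\<in>orb ` E. \<Sum>x\<in>{x \<in> E. orb x = t}. hits x (s x))"
    by (rule sum.group[symmetric]) (use fin in auto)
  also have "\<dots> = (\<Sum>t\<in>orb ` E. n * of_bool (s ` t = t))"
  proof (rule sum.cong[OF refl])
    fix t assume "t \<in> orb ` E"
    then obtain x where x: "x \<in> E" "t = orb x" by blast
    have t: "{y \<in> E. orb y = t} = t"
      using x orb_sub_X[OF x(1)] self_in_orb orb_eq by blast
    show "(\<Sum>x\<in>{x \<in> E. orb x = t}. hits x (s x)) = n * of_bool (s ` t = t)"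
    proof (cases "s ` t = t")
      case True
      have finT: "finite t" "t \<noteq> {}" using orb_sub_X[OF x(1)] fin self_in_orb finite_subset x(2) by blast+
      \<comment> \<open>The factor \<open>card t\<close> avoids division: every summand becomes
        \<open>n\<close>, and the nonzero factor cancels afterwards.\<close>
      have "card t * hits y (s y) = n" if "y \<in> t" for y
      proof -
        have "orb y = t" "y \<in> E" using that t by auto
        moreover have "s y \<in> t" using True that by blast
        ultimately show ?thesis using card_orb_mult_hits[of y "s y"] by simp
      qed
      then have "card t * (\<Sum>y\<in>t. hits y (s y)) = card t * n"
        by (simp add: sum_distrib_left)
      then show ?thesis using True finT t by simp
    next
      case False
      have "hits y (s y) = 0" if "y \<in> t" for y
      proof -
        have y: "orb y = t" using that t by auto
        have "s y \<notin> orb y"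
        proof
          assume "s y \<in> orb y"
          then have "orb (s y) = orb y" by (rule orb_eq)
          then show False using s_orb[of y] y False by simp
        qed
        then have "{k. k < n \<and> (r ^^ k) y = s y} = {}" by (auto simp: orb_def) (metis rangeI)
        then show ?thesis unfolding hits_def by (simp only: card.empty)
      qed
      then show ?thesis using False t by simp
    qed
  qed
  also have "\<dots> = n * card {t \<in> orb ` E. s ` t = t}"
    using fin by (simp add: sum_distrib_left[symmetric] Int_def)
  finally show ?thesis .
qed

text \<open>Conjugating \<open>s \<circ> r ^^ k\<close> by a power of \<open>r\<close> changes \<open>k\<close> by an even number.\<close>

lemma card_fixed_conj:
  "card {x \<in> E. s ((r ^^ k) x) = x} =
    (if even k then card {x \<in> E. s x = x} else card {x \<in> E. r (s x) = x})"
proof -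
  have *: "s ((r ^^ (a + b)) x) = x \<longleftrightarrow> s ((r ^^ a) x) = (r ^^ b) x" for a b x
  proof -
    have "s ((r ^^ (a + b)) x) = x \<longleftrightarrow> (r ^^ b) (s ((r ^^ (a + b)) x)) = (r ^^ b) x"
      using pow_inverse by metis
    moreover have "(r ^^ (a + b)) x = (r ^^ b) ((r ^^ a) x)" by (metis add.commute comp_apply funpow_add)
    ultimately show ?thesis by (simp only: pow_s_pow)
  qed
  have **: "card {x \<in> E. p ((r ^^ j) x)} = card {x \<in> E. p x}" for p j
  proof -
    have inj: "inj_on (r ^^ j) E" and im: "(r ^^ j) ` E = E"
      using bij_pow[of j] by (simp_all add: bij_betw_def)
    have "{x \<in> E. p x} = {x \<in> (r ^^ j) ` E. p x}" by (simp only: im)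
    also have "\<dots> = (r ^^ j) ` {x \<in> E. p ((r ^^ j) x)}" by blast
    finally show ?thesis by (simp only: card_image[OF inj_on_subset[OF inj Collect_restrict]])
  qed
  show ?thesis
  proof (cases "even k")
    case True
    then obtain j where k: "k = j + j" by (metis evenE mult_2)
    show ?thesis using True **[of "\<lambda>x. s x = x" j] unfolding k * by simp
  next
    case False
    then obtain i where "k = 2 * i + 1" by (rule oddE)
    \<comment> \<open>With \<open>z\<close> the image of \<open>x\<close> under \<open>Suc i\<close>
      rotations, the relation \<open>r_s_r\<close> turns the condition from \<open>*\<close> into
      \<open>r (s z) = z\<close>.\<close>
    then have k: "k = i + Suc i" by simp
    show ?thesis
      using False **[of "\<lambda>x. r (s x) = x" "Suc i"] unfolding k * by (simp add: r_s_r)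
  qed
qed

text \<open>Give a rotation orbit weight 2 if it is stable under \<open>s\<close> and weight 1
  otherwise. Each dihedral orbit, being one stable orbit or two exchanged ones, then has total
  weight 2.\<close>

lemma card_orbit_pairs:
  "2 * card ((\<lambda>x. orb x \<union> s ` orb x) ` E) = card (orb ` E) + card {t \<in> orb ` E. s ` t = t}"
proof -
  let ?T = "orb ` E" and ?g = "\<lambda>t. t \<union> s ` t"
  have "card ?T + card {t \<in> ?T. s ` t = t} = (\<Sum>t\<in>?T. 1 + of_bool (s ` t = t))"
    unfolding sum.distrib using fin by (simp add: Int_def)
  also have "\<dots> = (\<Sum>d\<in>?g ` ?T. \<Sum>t\<in>{t \<in> ?T. ?g t = d}. 1 + of_bool (s ` t = t))"
    by (rule sum.group[symmetric]) (use fin in auto)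
  also have "\<dots> = (\<Sum>d\<in>?g ` ?T. 2)"
  proof (rule sum.cong[OF refl])
    fix d assume "d \<in> ?g ` ?T"
    then obtain x where x: "x \<in> E" "d = orb x \<union> s ` orb x" by blast
    have "{t \<in> ?T. ?g t = d} = {orb x, s ` orb x}"
    proof
      show "{t \<in> ?T. ?g t = d} \<subseteq> {orb x, s ` orb x}"
      proof
        fix t assume t: "t \<in> {t \<in> ?T. ?g t = d}"
        then obtain y where y: "t = orb y" by blast
        then have "y \<in> orb x \<union> orb (s x)" using self_in_orb[of y] t x s_orb[of x] by blast
        then show "t \<in> {orb x, s ` orb x}" using orb_eq y s_orb by blast
      qed
      show "{orb x, s ` orb x} \<subseteq> {t \<in> ?T. ?g t = d}"
        using x s_in[OF x(1)] s_orb[of x] s_orb[of "s x"] by (auto simp: s_s)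
    qed
    moreover have "s ` s ` orb x = orb x" by (simp add: image_image s_s)
    ultimately show "(\<Sum>t\<in>{t \<in> ?T. ?g t = d}. 1 + of_bool (s ` t = t)) = 2"
      by (cases "s ` orb x = orb x") auto
  qed
  finally show ?thesis by (simp add: image_image)
qed

end

section \<open>The dihedral action on non-crossing partitions\<close>

lemma rotation_reflection_rotation: "rotation L (reflection L (rotation L x)) = reflection L x"
proof -
  consider "x \<notin> {1..L}" | "x \<in> {1..L}" "x = L" | "x \<in> {1..L}" "x < L" by fastforce
  then show ?thesis
  proof cases
    case 3
    then have "rotation L x = x + 1" by (simp add: rotation_def)
    moreover have "reflection L (x + 1) = L - x" using 3 by (simp add: reflection_def)
    moreover have "rotation L (L - x) = L - x + 1" using 3 by (simp add: rotation_def)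
    ultimately show ?thesis using 3 by (simp add: reflection_def)
  qed (auto simp: rotation_def reflection_def)
qed

lemma rotation_pow: "x \<in> {1..L} \<Longrightarrow> (rotation L ^^ k) x = (x - 1 + k) mod L + 1"
proof (induction k)
  case (Suc k)
  have "(x - 1 + k) mod L < L" using Suc.prems by simp
  then have "rotation L ((x - 1 + k) mod L + 1) = ((x - 1 + k) mod L + 1) mod L + 1"
    by (simp add: rotation_def)
  then have "(rotation L ^^ Suc k) x = ((x - 1 + k) mod L + 1) mod L + 1"
    by (simp only: funpow.simps comp_apply Suc.IH[OF Suc.prems])
  then show ?case by (simp only: Suc_eq_plus1[symmetric] mod_Suc_eq add_Suc_right)
qed auto

lemma rotation_pow_order: "(rotation L ^^ L) x = x"
proof (cases "x \<in> {1..L}")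
  case False
  then have "(rotation L ^^ k) x = x" for k by (induction k) (auto simp: rotation_def)
  then show ?thesis .
next
  case True
  then have "x - 1 < L" by auto
  then have "(x - 1 + L) mod L = x - 1" by simp
  then show ?thesis using rotation_pow[OF True, of L] True by simp
qed

lemma dihedral_action_points:
  assumes "L \<ge> 1"
  shows "dihedral_action L (rotation L) (reflection L) {1..L}"
proof
  show "reflection L (reflection L x) = x" for x by (auto simp: reflection_def)
qed (use assms rotation_pow_order rotation_reflection_rotation permutes_in_image[OF rotation_permutes[of L]]
    permutes_in_image[OF reflection_permutes[of L]] in auto)

lemma image_image_funpow:
  fixes g :: "'a \<Rightarrow> 'a"
  shows "((`) ((`) g)) ^^ k = (`) ((`) (g ^^ k))"
proof (induction k)
  case (Suc k)
  have "(`) (g ^^ Suc k) = (`) g \<circ> (`) (g ^^ k)" by (simp add: fun_eq_iff image_image)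
  then have "(`) ((`) (g ^^ Suc k)) = (`) ((`) g) \<circ> (`) ((`) (g ^^ k))"
    by (intro ext) (simp only: comp_apply image_comp)
  then show ?case using Suc.IH by (simp only: funpow.simps)
qed (simp add: fun_eq_iff)

lemma dihedral_action_NCP:
  assumes "L \<ge> 1"
  shows "dihedral_action L ((`) ((`) (rotation L))) ((`) ((`) (reflection L))) (NCP L)"
proof -
  interpret p: dihedral_action L "rotation L" "reflection L" "{1..L}"
    by (rule dihedral_action_points[OF assms])
  have "rotation L ^^ L = id" using rotation_pow_order by auto
  then show ?thesis
    by unfold_locales
      (use assms in \<open>simp_all add: finite_NCP NCP_image_rotation NCP_image_reflection image_image_funpow
        image_image p.s_s p.r_s_r\<close>)
qed

section \<open>Elements of the generated groups\<close>

lemma carrier_rotation_group_eq: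
  assumes "L \<ge> 1"
  shows "carrier (rotation_group L) = range (\<lambda>k. rotation L ^^ k)"
proof -
  interpret G: group "sym_group L" by (rule sym_group_is_group)
  interpret p: dihedral_action L "rotation L" "reflection L" "{1..L}"
    by (rule dihedral_action_points[OF assms])
  have carr: "rotation L ^^ k \<in> carrier (sym_group L)" for k
    unfolding sym_group_carrier
  proof (induction k)
    case 0
    show ?case unfolding funpow.simps by (rule permutes_id)
  next
    case (Suc k)
    then show ?case unfolding funpow.simps by (rule permutes_compose[OF _ rotation_permutes])
  qed
  have inv: "inv\<^bsub>sym_group L\<^esub> (rotation L) = rotation L ^^ (L - 1)"
  proof (rule G.inv_equality)
    show "rotation L ^^ (L - 1) \<otimes>\<^bsub>sym_group L\<^esub> rotation L = \<one>\<^bsub>sym_group L\<^esub>"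
      using p.pow_inverse[of 1] by (auto simp: sym_group_mult sym_group_one)
  qed (use carr[of 1] carr in auto)
  have "g \<in> range (\<lambda>k. rotation L ^^ k)" if "g \<in> generate (sym_group L) {rotation L}" for g
    using that
  proof (induction rule: generate.induct)
    case one
    show ?case by (rule range_eqI[of _ _ 0]) (simp add: sym_group_one id_def)
  next
    case (incl h)
    then show ?case by (intro range_eqI[of _ _ 1]) simp
  next
    case (inv h)
    then show ?case using \<open>inv\<^bsub>sym_group L\<^esub> (rotation L) = _\<close> by blast
  next
    case (eng g h)
    then obtain a b where "g = rotation L ^^ a" "h = rotation L ^^ b" by blast
    then show ?case by (intro range_eqI[of _ _ "a + b"]) (simp add: sym_group_mult funpow_add)
  qed
  moreover have "rotation L ^^ k \<in> generate (sym_group L) {rotation L}" for k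
  proof (induction k)
    case 0
    show ?case using generate.one[of "sym_group L"] by (simp add: sym_group_one id_def)
  next
    case (Suc k)
    then show ?case using generate.eng[OF generate.incl Suc, of "rotation L"]
      by (simp only: sym_group_mult funpow.simps singletonI)
  qed
  ultimately show ?thesis unfolding carrier_rotation_group by blast
qed

lemma carrier_rotation_reflection_group_eq:
  assumes "L \<ge> 1"
  shows "carrier (rotation_reflection_group L) =
    range (\<lambda>k. rotation L ^^ k) \<union> range (\<lambda>k. reflection L \<circ> rotation L ^^ k)"
    (is "_ = ?R \<union> ?S")
proof -
  interpret G: group "sym_group L" by (rule sym_group_is_group)
  interpret p: dihedral_action L "rotation L" "reflection L" "{1..L}"
    by (rule dihedral_action_points[OF assms])
  have RG: "?R \<subseteq> generate (sym_group L) {rotation L, reflection L}"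
    using G.mono_generate[of "{rotation L}" "{rotation L, reflection L}"]
    by (simp flip: carrier_rotation_group_eq[OF assms] add: carrier_rotation_group)
  have inv_s: "inv\<^bsub>sym_group L\<^esub> (reflection L) = reflection L"
    by (rule G.inv_equality)
      (use reflection_permutes[of L] in \<open>auto simp: sym_group_mult sym_group_one sym_group_carrier p.s_s\<close>)
  have inv_r: "inv\<^bsub>sym_group L\<^esub> (rotation L) \<in> ?R"
    using generate.inv[of "rotation L" "{rotation L}" "sym_group L"] carrier_rotation_group_eq[OF assms]
    by (simp add: carrier_rotation_group)
  have closed: "g \<circ> h \<in> ?R \<union> ?S" if gh: "g \<in> ?R \<union> ?S" "h \<in> ?R \<union> ?S" for g h
  proof -
    \<comment> \<open>Moving a reflection to the left past rotations inverts their exponent; this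
      brings every product into the normal form.\<close>
    have rs: "rotation L ^^ k \<circ> reflection L = reflection L \<circ> rotation L ^^ (k * (L - 1))" for k
    proof
      fix x
      have "(rotation L ^^ k) (reflection L x) = reflection L (reflection L ((rotation L ^^ k) (reflection L x)))"
        by (simp only: p.s_s)
      also have "\<dots> = reflection L ((rotation L ^^ (k * (L - 1))) x)"
        by (simp only: p.s_pow p.s_s)
      finally show "(rotation L ^^ k \<circ> reflection L) x = (reflection L \<circ> rotation L ^^ (k * (L - 1))) x" by simp
    qed
    have ss: "reflection L \<circ> reflection L = id" using p.s_s by auto
    consider (1) a b where "g = rotation L ^^ a" "h = rotation L ^^ b"
      | (2) a b where "g = rotation L ^^ a" "h = reflection L \<circ> rotation L ^^ b"
      | (3) a b where "g = reflection L \<circ> rotation L ^^ a" "h = rotation L ^^ b"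
      | (4) a b where "g = reflection L \<circ> rotation L ^^ a" "h = reflection L \<circ> rotation L ^^ b"
      using gh by blast
    then show ?thesis
    proof cases
      case 1
      then have "g \<circ> h = rotation L ^^ (a + b)" by (simp add: funpow_add)
      then show ?thesis by blast
    next
      case 2
      then have "g \<circ> h = (rotation L ^^ a \<circ> reflection L) \<circ> rotation L ^^ b" by (simp add: comp_assoc)
      also have "\<dots> = reflection L \<circ> rotation L ^^ (a * (L - 1) + b)"
        unfolding rs by (simp add: funpow_add comp_assoc)
      finally show ?thesis by blast
    next
      case 3
      then have "g \<circ> h = reflection L \<circ> rotation L ^^ (a + b)" by (simp add: funpow_add comp_assoc)
      then show ?thesis by blast
    next
      case 4
      then have "g \<circ> h = reflection L \<circ> (rotation L ^^ a \<circ> reflection L) \<circ> rotation L ^^ b"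
        by (simp add: comp_assoc)
      also have "\<dots> = (reflection L \<circ> reflection L) \<circ> rotation L ^^ (a * (L - 1) + b)"
        unfolding rs by (simp add: funpow_add comp_assoc)
      finally have "g \<circ> h = rotation L ^^ (a * (L - 1) + b)" unfolding ss by simp
      then show ?thesis by blast
    qed
  qed
  have id_R: "id \<in> ?R" by (rule range_eqI[of _ _ 0]) (simp add: id_def)
  have r_R: "rotation L \<in> ?R" by (rule range_eqI[of _ _ 1]) simp
  have s_S: "reflection L \<in> ?S" by (rule range_eqI[of _ _ 0]) (simp add: comp_def)
  have "g \<in> ?R \<union> ?S" if "g \<in> generate (sym_group L) {rotation L, reflection L}" for g
    using that
  proof (induction rule: generate.induct)
    case one
    show ?case unfolding sym_group_one using id_R by (rule UnI1)
  next
    case (incl h)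
    then show ?case using r_R s_S by blast
  next
    case (inv h)
    then consider "h = rotation L" | "h = reflection L" by blast
    then show ?case by cases (simp_all only: inv_s UnI1[OF inv_r] UnI2[OF s_S])
  next
    case (eng g h)
    show ?case unfolding sym_group_mult by (rule closed[OF eng.IH])
  qed
  moreover have "?S \<subseteq> generate (sym_group L) {rotation L, reflection L}"
  proof
    fix g assume "g \<in> ?S"
    then obtain k where k: "g = reflection L \<circ> rotation L ^^ k" by blast
    have "rotation L ^^ k \<in> generate (sym_group L) {rotation L, reflection L}" using RG by blast
    from generate.eng[OF generate.incl this, of "reflection L"]
    show "g \<in> generate (sym_group L) {rotation L, reflection L}" by (simp add: sym_group_mult k)
  qed
  ultimately show ?thesis unfolding carrier_rotation_reflection_group using RG by blast
qed

theorem corollary2p1: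
  fixes L :: nat
  assumes "L \<ge> 1"
  shows "real (N_Z_sq_PF L) = 1 / 2 * (real (N_Z_tri_PF L) + real (L choose (L div 2)))"
proof -
  let ?r = "(`) ((`) (rotation L))" and ?s = "(`) ((`) (reflection L))"
  interpret d: dihedral_action L ?r ?s "NCP L" by (rule dihedral_action_NCP[OF assms])
  have orbit: "orbit G (partition_action L) P = (\<lambda>g. (`) g ` P) ` carrier G" if "P \<in> NCP L"
    for G :: "(nat \<Rightarrow> nat) monoid" and P
    using that by (auto simp: orbit_def partition_action_def)
  have rot: "orbit (rotation_group L) (partition_action L) P = d.orb P" if "P \<in> NCP L" for P
    unfolding orbit[OF that] d.orb_def carrier_rotation_group_eq[OF assms]
    by (simp add: image_image_funpow image_image)
  have dih: "orbit (rotation_reflection_group L) (partition_action L) P = d.orb P \<union> ?s ` d.orb P"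
    if "P \<in> NCP L" for P
    unfolding orbit[OF that] d.orb_def carrier_rotation_reflection_group_eq[OF assms]
    by (simp add: image_image_funpow image_image image_Un)
  have "orbits (rotation_group L) (NCP L) (partition_action L) = d.orb ` NCP L"
    by (simp add: orbits_def Setcompr_eq_image rot cong: image_cong_simp)
  then have tri: "N_Z_tri_PF L = card (d.orb ` NCP L)" by (simp add: N_Z_tri_PF_def)
  have "orbits (rotation_reflection_group L) (NCP L) (partition_action L) =
      (\<lambda>P. d.orb P \<union> ?s ` d.orb P) ` NCP L"
    by (simp add: orbits_def Setcompr_eq_image dih cong: image_cong_simp)
  then have sq: "N_Z_sq_PF L = card ((\<lambda>P. d.orb P \<union> ?s ` d.orb P) ` NCP L)"
    by (simp add: N_Z_sq_PF_def)
  \<comment> \<open>Every exponent \<open>k\<close> reduces by parity to one of the two axes, and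
    both have the same count, so the sum over \<open>k < L\<close> is \<open>L\<close> times that
    count.\<close>
  have "card {P \<in> NCP L. ?s ((?r ^^ k) P) = P} = (L choose (L div 2))" for k
    using card_fixed_reflection[of L] card_fixed_rotation_reflection[OF assms]
    unfolding d.card_fixed_conj by (simp add: image_image)
  then have "L * (L choose (L div 2)) = L * card {t \<in> d.orb ` NCP L. ?s ` t = t}"
    using d.sum_card_fixed by simp
  then have "(L choose (L div 2)) = card {t \<in> d.orb ` NCP L. ?s ` t = t}" using assms by simp
  then have "2 * N_Z_sq_PF L = N_Z_tri_PF L + (L choose (L div 2))"
    using d.card_orbit_pairs tri sq by simp
  then have "real (2 * N_Z_sq_PF L) = real (N_Z_tri_PF L + (L choose (L div 2)))" by simp
  then show ?thesis by simp
qed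

end
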